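(* Let $\{J_R\}$ be real numbers indexed by the finite subsets $R$ of $\mathbb{Z}$ with $\sum_{R\ni x}|J_R|<\infty$ for each $x\in\mathbb{Z}$, and with $J_{R+k}=J_R$ for all $k\in\mathbb{Z}$ and all $R$ with $|R|\ge2$. Suppose that the one particle potential $J_{\{x\}}$ approaches $\mp\infty$ as $x$ approaches $\pm\infty$, respectively, sufficiently fast that $$\sum_{x\ge1}\exp\bigl(2J_{\{x\}}\bigr)<\infty\qquad\text{and}\qquad\sum_{x\le0}\exp\bigl(-2J_{\{x\}}\bigr)<\infty.$$ Then $\nu=\lim_{N\to\infty}\nu_N$ exists (as a weak limit of probability measures on $\{0,1\}^{\mathbb{Z}}$) and is a blocking measure, where $\nu_N$ are the finite-volume Gibbs measures of the potential $\{J_R\}$ with boundary condition $\eta^H$. Moreover, if rates $p(x,y;\eta)$ satisfying the standing assumptions on rates satisfy the detailed balance condition $$p(x,y;\eta)\,e^{-\sum_{\{R\,:\,x\in R\text{ or }y\in R\}}J_R\,\chi_R(\eta)}=p(y,x;\eta^{x,y})\,e^{-\sum_{\{R\,:\,x\in R\text{ or }y\in R\}}J_R\,\chi_R(\eta^{x,y})}$$ for all $x,y\in\mathbb{Z}$ and all $\eta\in\{0,1\}^{\mathbb{Z}}$, then $\nu$ is reversible for the exclusion process with rates $p$.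
   Context: Gibbs measures. $\chi_R(\zeta)=\prod_{x\in R}(2\zeta(x)-1)$ for $\zeta\in\{0,1\}^{\mathbb{Z}}$ and $R\subset\mathbb{Z}$ finite. The Heaviside configuration $\eta^H$ is given by $\eta^H(x)=1$ if $x\ge1$ and $\eta^H(x)=0$ if $x\le0$. For $N\ge1$ let $T_N=[-N+1,N]\cap\mathbb{Z}$ and $Y_N=\{0,1\}^{T_N}$. For $\eta\in Y_N$ let $\eta^*\in\{0,1\}^{\mathbb{Z}}$ be the configuration which agrees with $\eta$ on $T_N$ and with $\eta^H$ outside $T_N$. The energy of $\eta\in Y_N$ is $H_N(\eta)=\sum_{\{R\,:\,R\cap T_N\ne\emptyset\}}J_R\,\chi_R(\eta^* )$. The finite-volume Gibbs measure on $Y_N$ is $\nu_N(\{\eta\})=Z_N^{-1}\exp(-H_N(\eta))$, with $Z_N=\sum_{\zeta\in Y_N}\exp(-H_N(\zeta))$; it is regarded as a measure on $\{0,1\}^{\mathbb{Z}}$ by setting $\nu_N(A)=\nu_N(\{\eta\in Y_N:\eta^*\in A\})$. Exclusion process. For $\eta\in\{0,1\}^{\mathbb{Z}}$ and $x,y\in\mathbb{Z}$, $\eta^{x,y}$ is the configuration obtained from $\eta$ by exchanging the values at $x$ and $y$. Rates are functions $p(x,y;\eta)\ge 0$, continuous in $\eta$ (product topology), with $p(x,y;\eta)=0$ unless $\eta(x)=1$ and $\eta(y)=0$. The exclusion process with rates $p$ has generator $Lf(\eta)=\sum_{x\in\mathbb{Z}}\sum_{y\in\mathbb{Z}}p(x,y;\eta)[f(\eta^{x,y})-f(\eta)]$.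 Blocking configurations. For $n\in\mathbb{Z}$ let $\mathcal{X}_n=\{\eta\in\{0,1\}^{\mathbb{Z}}:\sum_{x\le n}\eta(x)=\sum_{x>n}(1-\eta(x))<\infty\}$ and $\mathcal{X}=\bigcup_n\mathcal{X}_n$, a countable set. A blocking measure is a probability measure supported on $\mathcal{X}$. Standing assumptions on rates: (i) $0\le p(x,y;\eta)\le 1$; (ii) for every $\zeta\in\mathcal{X}$, $\sum_x\sum_y p(x,y;\zeta)<\infty$. On $\mathcal{X}$ the process is the continuous time Markov jump chain that jumps from $\eta$ to $\eta^{x,y}$ at rate $p(x,y;\eta)$ (constructed jump by jump, i.e. the minimal chain). A blocking measure $\nu$ is reversible for the process if $\int f\,P_tg\,d\nu=\int g\,P_tf\,d\nu$ for all $t\ge0$ and all bounded $f,g:\mathcal{X}\to\mathbb{R}$, where $P_t$ is the transition semigroup of this chain. *)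

theory Defs
  imports "HOL-Probability.Probability"
begin

text \<open>
  Configurations in \<open>{0,1}\<^sup>\<int>\<close>, with \<open>True\<close> for \<open>1\<close>. The topology on the function type
  is the product of the discrete topologies, and \<^term>\<open>borel\<close> is its Borel \<open>\<sigma>\<close>-algebra.
\<close>

type_synonym config = "int \<Rightarrow> bool"


subsection \<open>Gibbs measures\<close>

definition chi :: "int set \<Rightarrow> config \<Rightarrow> real" where
  "chi R \<zeta> = (\<Prod>x\<in>R. 2 * of_bool (\<zeta> x) - 1)"

definition heaviside :: config where
  "heaviside x \<longleftrightarrow> x \<ge> 1"

definition box :: "nat \<Rightarrow> int set" where
  "box N = {- int N + 1 .. int N}"

definition box_configs :: "nat \<Rightarrow> config set" where
  "box_configs N = (box N \<rightarrow>\<^sub>E UNIV)"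

definition extend :: "nat \<Rightarrow> config \<Rightarrow> config" where
  "extend N \<eta> = (\<lambda>x. if x \<in> box N then \<eta> x else heaviside x)"

text \<open>A potential is a function on all sets of integers; only its values on finite sets are used.\<close>

definition energy :: "(int set \<Rightarrow> real) \<Rightarrow> nat \<Rightarrow> config \<Rightarrow> real" where
  "energy J N \<eta> = (\<Sum>\<^sub>\<infinity>R\<in>{R. finite R \<and> R \<inter> box N \<noteq> {}}. J R * chi R (extend N \<eta>))"

definition partition_function :: "(int set \<Rightarrow> real) \<Rightarrow> nat \<Rightarrow> real" where
  "partition_function J N = (\<Sum>\<zeta>\<in>box_configs N. exp (- energy J N \<zeta>))"

definition gibbs_box :: "(int set \<Rightarrow> real) \<Rightarrow> nat \<Rightarrow> config measure" where
  "gibbs_box J N =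
     point_measure (box_configs N) (\<lambda>\<eta>. ennreal (exp (- energy J N \<eta>) / partition_function J N))"

definition gibbs :: "(int set \<Rightarrow> real) \<Rightarrow> nat \<Rightarrow> config measure" where
  "gibbs J N = distr (gibbs_box J N) borel (extend N)"

definition converges_weakly ::
  "(nat \<Rightarrow> 'a::topological_space measure) \<Rightarrow> 'a measure \<Rightarrow> bool" where
  "converges_weakly \<mu>s \<mu> \<longleftrightarrow>
     (\<forall>f :: 'a \<Rightarrow> real. continuous_on UNIV f \<and> bounded (range f) \<longrightarrow>
        (\<lambda>N. \<integral>\<eta>. f \<eta> \<partial>\<mu>s N) \<longlonglongrightarrow> (\<integral>\<eta>. f \<eta> \<partial>\<mu>))"


subsection \<open>Blocking configurations and measures\<close>

definition blocking_level :: "int \<Rightarrow> config set" where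
  "blocking_level n =
     {\<eta>. (\<Sum>\<^sub>\<infinity>x\<in>{..n}. of_bool (\<eta> x) :: ennreal) = (\<Sum>\<^sub>\<infinity>x\<in>{n<..}. 1 - of_bool (\<eta> x)) \<and>
         (\<Sum>\<^sub>\<infinity>x\<in>{..n}. of_bool (\<eta> x) :: ennreal) < \<infinity>}"

definition blocking_configs :: "config set" where
  "blocking_configs = (\<Union>n. blocking_level n)"

definition blocking_measure :: "config measure \<Rightarrow> bool" where
  "blocking_measure \<nu> \<longleftrightarrow>
     sets \<nu> = sets borel \<and> prob_space \<nu> \<and> (AE \<eta> in \<nu>. \<eta> \<in> blocking_configs)"


subsection \<open>Exclusion rates\<close>

definition exchange :: "int \<Rightarrow> int \<Rightarrow> config \<Rightarrow> config" where
  "exchange x y \<eta> = \<eta>(x := \<eta> y, y := \<eta> x)"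

definition exclusion_rates :: "(int \<Rightarrow> int \<Rightarrow> config \<Rightarrow> real) \<Rightarrow> bool" where
  "exclusion_rates p \<longleftrightarrow>
     (\<forall>x y \<eta>. 0 \<le> p x y \<eta>) \<and>
     (\<forall>x y. continuous_on UNIV (p x y)) \<and>
     (\<forall>x y \<eta>. \<not> (\<eta> x \<and> \<not> \<eta> y) \<longrightarrow> p x y \<eta> = 0)"

definition standing_assumptions :: "(int \<Rightarrow> int \<Rightarrow> config \<Rightarrow> real) \<Rightarrow> bool" where
  "standing_assumptions p \<longleftrightarrow>
     (\<forall>x y \<eta>. 0 \<le> p x y \<eta> \<and> p x y \<eta> \<le> 1) \<and>
     (\<forall>\<zeta>\<in>blocking_configs. (\<lambda>(x, y). p x y \<zeta>) summable_on UNIV)"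

definition local_energy :: "(int set \<Rightarrow> real) \<Rightarrow> int \<Rightarrow> int \<Rightarrow> config \<Rightarrow> real" where
  "local_energy J x y \<eta> = (\<Sum>\<^sub>\<infinity>R\<in>{R. finite R \<and> (x \<in> R \<or> y \<in> R)}. J R * chi R \<eta>)"

definition detailed_balance ::
  "(int set \<Rightarrow> real) \<Rightarrow> (int \<Rightarrow> int \<Rightarrow> config \<Rightarrow> real) \<Rightarrow> bool" where
  "detailed_balance J p \<longleftrightarrow>
     (\<forall>x y \<eta>. p x y \<eta> * exp (- local_energy J x y \<eta>) =
        p y x (exchange x y \<eta>) * exp (- local_energy J x y (exchange x y \<eta>)))"


subsection \<open>The minimal jump chain\<close>

definition total_rate :: "(int \<Rightarrow> int \<Rightarrow> config \<Rightarrow> real) \<Rightarrow> config \<Rightarrow> real" where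
  "total_rate p \<zeta> = (\<Sum>\<^sub>\<infinity>(x, y)\<in>UNIV. p x y \<zeta>)"

text \<open>
  The law of the pair of sites exchanged at a jump out of \<open>\<zeta>\<close>. An absorbing \<open>\<zeta>\<close> gets the
  trivial exchange, which is never performed because the holding time is infinite.
\<close>

definition jump_pmf :: "(int \<Rightarrow> int \<Rightarrow> config \<Rightarrow> real) \<Rightarrow> config \<Rightarrow> (int \<times> int) pmf" where
  "jump_pmf p \<zeta> =
     (if total_rate p \<zeta> = 0 then return_pmf (0, 0)
      else embed_pmf (\<lambda>(x, y). p x y \<zeta> / total_rate p \<zeta>))"

text \<open>
  The chain is driven by independent instructions, one for each \<open>(n, \<zeta>)\<close>. The instruction
  at \<open>(n, \<zeta>)\<close> is used when the chain is at \<open>\<zeta>\<close> after \<open>n\<close> jumps; it consists of the pair of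
  sites to exchange next and an independent standard exponential variable, which becomes
  the holding time at \<open>\<zeta>\<close> after division by \<open>total_rate p \<zeta>\<close>. As \<open>n\<close> increases from one jump
  to the next, no instruction is used twice: given the past, the next exchange is chosen
  with probabilities \<open>p x y \<zeta> / total_rate p \<zeta>\<close>, and the holding time is independent of it
  and exponential with parameter \<open>total_rate p \<zeta>\<close>.
\<close>

type_synonym instructions = "nat \<times> config \<Rightarrow> (int \<times> int) \<times> real"

definition instruction_measure ::
  "(int \<Rightarrow> int \<Rightarrow> config \<Rightarrow> real) \<Rightarrow> instructions measure" where
  "instruction_measure p =
     (\<Pi>\<^sub>M (n, \<zeta>)\<in>UNIV.
        measure_pmf (jump_pmf p \<zeta>) \<Otimes>\<^sub>M density lborel (\<lambda>s. ennreal (exponential_density 1 s)))"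

primrec jump_chain :: "instructions \<Rightarrow> config \<Rightarrow> nat \<Rightarrow> config" where
  "jump_chain \<omega> \<eta> 0 = \<eta>"
| "jump_chain \<omega> \<eta> (Suc n) =
     (case fst (\<omega> (n, jump_chain \<omega> \<eta> n)) of (x, y) \<Rightarrow> exchange x y (jump_chain \<omega> \<eta> n))"

text \<open>In \<^typ>\<open>ennreal\<close>, \<open>e / 0 = \<infinity>\<close> for \<open>e > 0\<close>, so the chain stays forever in a state with
  total rate \<open>0\<close>.\<close>

definition holding_time ::
  "(int \<Rightarrow> int \<Rightarrow> config \<Rightarrow> real) \<Rightarrow> instructions \<Rightarrow> config \<Rightarrow> nat \<Rightarrow> ennreal" where
  "holding_time p \<omega> \<eta> n =
     ennreal (snd (\<omega> (n, jump_chain \<omega> \<eta> n))) / ennreal (total_rate p (jump_chain \<omega> \<eta> n))"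

definition jump_time ::
  "(int \<Rightarrow> int \<Rightarrow> config \<Rightarrow> real) \<Rightarrow> instructions \<Rightarrow> config \<Rightarrow> nat \<Rightarrow> ennreal" where
  "jump_time p \<omega> \<eta> n = (\<Sum>k<n. holding_time p \<omega> \<eta> k)"

text \<open>The state at time \<open>t\<close> of the chain started in \<open>\<eta>\<close>; \<open>None\<close> if infinitely many jumps have
  occurred by time \<open>t\<close>.\<close>

definition chain_at ::
  "(int \<Rightarrow> int \<Rightarrow> config \<Rightarrow> real) \<Rightarrow> instructions \<Rightarrow> config \<Rightarrow> real \<Rightarrow> config option" where
  "chain_at p \<omega> \<eta> t =
     (if \<exists>n. ennreal t < jump_time p \<omega> \<eta> n
      then Some (jump_chain \<omega> \<eta> (LEAST n. ennreal t < jump_time p \<omega> \<eta> (Suc n)))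
      else None)"

definition semigroup ::
  "(int \<Rightarrow> int \<Rightarrow> config \<Rightarrow> real) \<Rightarrow> real \<Rightarrow> (config \<Rightarrow> real) \<Rightarrow> config \<Rightarrow> real" where
  "semigroup p t f \<eta> =
     (\<integral>\<omega>. (case chain_at p \<omega> \<eta> t of None \<Rightarrow> 0 | Some \<zeta> \<Rightarrow> f \<zeta>) \<partial>instruction_measure p)"

text \<open>
  Functions on \<^term>\<open>blocking_configs\<close> are represented by functions on all configurations whose
  values elsewhere are irrelevant. The integrals are therefore restricted to the countable
  set \<^term>\<open>blocking_configs\<close>, on which every function is measurable.
\<close>

definition reversible ::
  "(int \<Rightarrow> int \<Rightarrow> config \<Rightarrow> real) \<Rightarrow> config measure \<Rightarrow> bool" where
  "reversible p \<nu> \<longleftrightarrow>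
     (\<forall>t\<ge>0. \<forall>f g :: config \<Rightarrow> real.
        bounded (f ` blocking_configs) \<and> bounded (g ` blocking_configs) \<longrightarrow>
        (LINT \<eta>:blocking_configs|\<nu>. f \<eta> * semigroup p t g \<eta>) =
        (LINT \<eta>:blocking_configs|\<nu>. g \<eta> * semigroup p t f \<eta>))"

end

theory Submission
  imports Defs
begin

text \<open>
  A configuration is blocking exactly when it differs from the Heaviside configuration at finitely
  many sites. Such an \<open>\<eta>\<close> has a finite energy relative to the Heaviside configuration,
  \<open>\<Delta>(\<eta>) = \<Sum>\<^sub>R J\<^sub>R (chi R \<eta> - chi R heaviside)\<close>, in which only the sets \<open>R\<close> that meet the
  finite defect set \<open>D\<close> contribute. For \<open>\<eta>\<close> in the box, \<open>H\<^sub>N(\<eta>)\<close> and \<open>\<Delta>(\<eta>\<^sup>*)\<close> differ by a constant,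
  so \<open>\<nu>\<^sub>N\<close> is the normalized restriction of the single weight \<open>exp (- \<Delta>)\<close> to the perturbations
  inside the box. These finite sets increase to the countable set of all blocking configurations.
  Hence everything about the limit follows once \<open>exp (- \<Delta>)\<close> is summable there: the limit \<open>\<nu>\<close> is
  the normalized weight, and it is carried by blocking configurations.

  Summability is a comparison with independent defects. The sets with at least two points cost at
  most \<open>2 c\<close> per defect, where \<open>c = \<Sum>{\<bar>J\<^sub>R\<bar> | 0 \<in> R, \<bar>R\<bar> \<ge> 2}\<close> is the same at every site by
  translation invariance, and the singletons give the factors \<open>exp (2 J\<^sub>x)\<close> or \<open>exp (- 2 J\<^sub>x)\<close>
  (\<open>exp_relative_energy_le\<close>). Summing a product of site weights \<open>b\<^sub>x\<close> over all finite defect sets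
  is bounded by \<open>\<Prod>(1 + b\<^sub>x) \<le> exp (\<Sum>b\<^sub>x) < \<infinity>\<close> (\<open>summable_weights\<close>).

  For reversibility, an exchange of \<open>x\<close> and \<open>y\<close> changes \<open>\<Delta>\<close> by the change of the local energy at
  \<open>{x, y}\<close>, so the hypothesis on the rates says \<open>w(\<xi>) q(\<xi>, \<zeta>) = w(\<zeta>) q(\<zeta>, \<xi>)\<close> for \<open>w = exp (- \<Delta>)\<close>
  and the jump rates \<open>q\<close> between blocking configurations. Let \<open>k\<^sub>n(\<eta>, \<zeta>, t)\<close> be the probability to
  be at \<open>\<zeta>\<close> at time \<open>t\<close> after exactly \<open>n\<close> jumps. Conditioning on the last jump yields a forward
  recursion for \<open>k\<^sub>n\<close> (\<open>occupation_eq_kernel\<close>); because convolutions commute, \<open>k\<^sub>n\<close> also obeys the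
  backward recursion that conditions on the first jump (\<open>kernel_backward\<close>). Detailed balance turns
  one recursion into the other read from \<open>\<zeta>\<close> to \<open>\<eta>\<close>, so \<open>w(\<eta>) k\<^sub>n(\<eta>, \<zeta>, t)\<close> is symmetric for every
  \<open>n\<close>. The minimal chain makes finitely many jumps before every time at which it is defined, so its
  transition probabilities are \<open>\<Sum>\<^sub>n k\<^sub>n\<close> whether or not it explodes, and Fubini's theorem finishes
  the proof.
\<close>

section \<open>Configurations and their finite perturbations\<close>

lemma infsum_of_bool_ennreal:
  "(\<Sum>\<^sub>\<infinity>x\<in>A. of_bool (P x) :: ennreal) =
     (if finite {x\<in>A. P x} then of_nat (card {x\<in>A. P x}) else \<infinity>)"
proof -
  have "(\<Sum>\<^sub>\<infinity>x\<in>A. of_bool (P x) :: ennreal) = (\<Sum>\<^sub>\<infinity>x\<in>{x\<in>A. P x}. 1)"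
    by (rule infsum_cong_neutral) auto
  also have "\<dots> = (if finite {x\<in>A. P x} then of_nat (card {x\<in>A. P x}) else \<infinity>)"
    using infsum_superconst_infinite_ennreal[of "{x\<in>A. P x}" 1 "\<lambda>_. 1"] by auto
  finally show ?thesis .
qed

lemma blocking_level_iff:
  "\<eta> \<in> blocking_level n \<longleftrightarrow> finite {x. x \<le> n \<and> \<eta> x} \<and> finite {x. n < x \<and> \<not> \<eta> x} \<and>
     card {x. x \<le> n \<and> \<eta> x} = card {x. n < x \<and> \<not> \<eta> x}"
proof -
  have 1: "(1 - of_bool b :: ennreal) = of_bool (\<not> b)" for b by auto
  have 2: "{x \<in> {..n}. \<eta> x} = {x. x \<le> n \<and> \<eta> x}" "{x \<in> {n<..}. \<not> \<eta> x} = {x. n < x \<and> \<not> \<eta> x}"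
    by auto
  have 3: "of_nat k < (\<top>::ennreal)" for k by (simp add: of_nat_less_top)
  have 4: "(\<top>::ennreal) \<noteq> of_nat k" for k by simp
  show ?thesis
    unfolding blocking_level_def mem_Collect_eq 1 infsum_of_bool_ennreal 2
    using 3 4 by auto
qed

text \<open>Moving the level up by one site raises the left count minus the right count by exactly one,
  whatever the value of the configuration there. Hence the two counts agree at some level.\<close>

lemma blocking_configs_eq: "blocking_configs = {\<eta>. finite {x. \<eta> x \<noteq> heaviside x}}"
proof (intro equalityI subsetI)
  fix \<eta> assume "\<eta> \<in> blocking_configs"
  then obtain n where n: "\<eta> \<in> blocking_level n" by (auto simp: blocking_configs_def)
  have "{x. \<eta> x \<noteq> heaviside x} \<subseteq> {x. x \<le> n \<and> \<eta> x} \<union> {x. n < x \<and> \<not> \<eta> x} \<union> {min 0 n..max 0 n}"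
    by (auto simp: heaviside_def)
  then show "\<eta> \<in> {\<eta>. finite {x. \<eta> x \<noteq> heaviside x}}"
    using n by (auto simp: blocking_level_iff intro: finite_subset)
next
  fix \<eta> assume "\<eta> \<in> {\<eta>. finite {x. \<eta> x \<noteq> heaviside x}}"
  then have fin: "finite {x. \<eta> x \<noteq> heaviside x}" by simp
  have L: "finite {x. x \<le> n \<and> \<eta> x}" for n
    by (rule finite_subset[OF _ finite_UnI[OF fin finite_atLeastAtMost[of 0 n]]])
       (auto simp: heaviside_def)
  have R: "finite {x. n < x \<and> \<not> \<eta> x}" for n
    by (rule finite_subset[OF _ finite_UnI[OF fin finite_atLeastAtMost[of n 0]]])
       (auto simp: heaviside_def)
  define \<phi> where "\<phi> n = int (card {x. x \<le> n \<and> \<eta> x}) - int (card {x. n < x \<and> \<not> \<eta> x})" for n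
  have step: "\<phi> (n + 1) = \<phi> n + 1" for n
  proof (cases "\<eta> (n + 1)")
    case True
    have "{x. x \<le> n + 1 \<and> \<eta> x} = insert (n + 1) {x. x \<le> n \<and> \<eta> x}"
      using True by (auto simp: le_less)
    moreover have "{x. n + 1 < x \<and> \<not> \<eta> x} = {x. n < x \<and> \<not> \<eta> x}"
    proof (intro Collect_cong iffI conjI)
      fix x assume x: "n < x \<and> \<not> \<eta> x"
      then have "x \<noteq> n + 1" using True by auto
      with x show "n + 1 < x" by linarith
    qed auto
    ultimately show ?thesis using L by (simp add: \<phi>_def)
  next
    case False
    have "{x. n < x \<and> \<not> \<eta> x} = insert (n + 1) {x. n + 1 < x \<and> \<not> \<eta> x}"
      using False by (auto simp: le_less)
    moreover have "{x. x \<le> n + 1 \<and> \<eta> x} = {x. x \<le> n \<and> \<eta> x}"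
    proof (intro Collect_cong iffI conjI)
      fix x assume x: "x \<le> n + 1 \<and> \<eta> x"
      then have "x \<noteq> n + 1" using False by auto
      with x show "x \<le> n" by linarith
    qed auto
    ultimately show ?thesis using R by (simp add: \<phi>_def)
  qed
  have "\<phi> n = \<phi> 0 + n" for n
  proof (induction n rule: int_induct[where k=0])
    case (step2 i) then show ?case using step[of "i - 1"] by simp
  qed (simp_all add: step)
  from this[of "- \<phi> 0"] have "\<phi> (- \<phi> 0) = 0" by linarith
  then have "\<eta> \<in> blocking_level (- \<phi> 0)"
    using L R by (auto simp: blocking_level_iff \<phi>_def)
  then show "\<eta> \<in> blocking_configs" by (auto simp: blocking_configs_def)
qed

lemma countable_blocking_configs: "countable blocking_configs"
proof -
  define S where "S = (\<lambda>\<eta>. {x. \<eta> x \<noteq> heaviside x})"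
  have inj: "inj_on S blocking_configs"
    unfolding S_def by (rule inj_onI) (auto simp: set_eq_iff fun_eq_iff)
  have "S ` blocking_configs \<subseteq> {D. finite D}"
    by (auto simp: S_def blocking_configs_eq)
  moreover have "countable {D :: int set. finite D}"
    using countable_Collect_finite by simp
  ultimately have "countable (S ` blocking_configs)" by (rule countable_subset)
  then show ?thesis using inj by (rule countable_image_inj_on)
qed

lemma exchange_exchange: "exchange y x (exchange x y \<eta>) = \<eta>"
  by (auto simp: exchange_def)

lemma exchange_off: "z \<noteq> x \<Longrightarrow> z \<noteq> y \<Longrightarrow> exchange x y \<eta> z = \<eta> z"
  by (simp add: exchange_def)

lemma exchange_in_blocking:
  assumes "\<eta> \<in> blocking_configs" shows "exchange x y \<eta> \<in> blocking_configs"
proof -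
  have "{z. exchange x y \<eta> z \<noteq> heaviside z} \<subseteq> {z. \<eta> z \<noteq> heaviside z} \<union> {x, y}"
    by (auto simp: exchange_def)
  then show ?thesis using assms by (auto simp: blocking_configs_eq intro: finite_subset)
qed


lemma nn_integral_count_space_eq_infsum:
  fixes f :: "'a \<Rightarrow> real"
  assumes "f summable_on A" and "\<And>x. x \<in> A \<Longrightarrow> f x \<ge> 0"
  shows "(\<integral>\<^sup>+x. ennreal (f x) \<partial>count_space A) = ennreal (infsum f A)"
proof -
  have "(\<lambda>x. norm (f x)) summable_on A"
    using assms by (subst summable_on_cong[where g = f]) auto
  then have "Infinite_Set_Sum.abs_summable_on f A" by (simp only: abs_summable_equivalent[symmetric])
  then show ?thesis
    using assms by (simp add: nn_integral_conv_infsetsum infsetsum_infsum)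
qed


section \<open>Borel sets of configurations\<close>

lemma closed_singleton_config: "closed {\<eta> :: config}"
proof -
  have "closed {\<zeta> :: config. \<zeta> x = \<eta> x}" for x
  proof -
    have "closed ((\<lambda>\<zeta> :: config. \<zeta> x) -` {\<eta> x})"
      using continuous_on_product_coordinates[of x] by (rule closed_vimage[rotated]) simp
    then show ?thesis by (simp add: vimage_def)
  qed
  then have "closed (\<Inter>x. {\<zeta> :: config. \<zeta> x = \<eta> x})" by (intro closed_INT) simp
  moreover have "(\<Inter>x. {\<zeta> :: config. \<zeta> x = \<eta> x}) = {\<eta>}" by (auto simp: fun_eq_iff)
  ultimately show ?thesis by simp
qed

lemma countable_config_borel:
  assumes "countable (A :: config set)" shows "A \<in> sets borel"
  by (rule sets.countable[OF borel_closed[OF closed_singleton_config] assms])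

text \<open>Off the blocking configurations nothing is known about the functions to be integrated against the
  limit measure; multiplied by the indicator of that countable set they become Borel.\<close>

lemma borel_measurable_countable_support:
  fixes f :: "config \<Rightarrow> real"
  assumes "countable A" and "\<And>\<eta>. \<eta> \<notin> A \<Longrightarrow> f \<eta> = 0"
  shows "f \<in> borel_measurable borel"
proof (rule measurableI)
  fix B :: "real set"
  have cnt: "countable (f -` B \<inter> A)" using assms(1) by auto
  have *: "f -` B = (f -` B \<inter> A) \<union> (if 0 \<in> B then - A else {})"
  proof (intro set_eqI iffI)
    fix \<eta> assume "\<eta> \<in> f -` B"
    then show "\<eta> \<in> (f -` B \<inter> A) \<union> (if 0 \<in> B then - A else {})"
      using assms(2)[of \<eta>] by (cases "\<eta> \<in> A") auto
  next
    fix \<eta> assume "\<eta> \<in> (f -` B \<inter> A) \<union> (if 0 \<in> B then - A else {})"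
    then show "\<eta> \<in> f -` B" using assms(2)[of \<eta>] by (auto split: if_splits)
  qed
  have "f -` B \<inter> A \<in> sets borel" "- A \<in> sets borel"
    using countable_config_borel[OF cnt] countable_config_borel[OF assms(1)] by auto
  then have "(f -` B \<inter> A) \<union> (if 0 \<in> B then - A else {}) \<in> sets borel" by auto
  then show "f -` B \<inter> space borel \<in> sets borel" by (simp only: space_borel Int_UNIV_right *[symmetric])
qed simp


section \<open>Energies of finite perturbations\<close>

lemma abs_chi [simp]: "\<bar>chi R \<eta>\<bar> = 1"
proof -
  have "\<bar>chi R \<eta>\<bar> = (\<Prod>x\<in>R. \<bar>2 * of_bool (\<eta> x) - 1\<bar>)"
    unfolding chi_def by (rule abs_prod)
  also have "\<dots> = 1" by (rule prod.neutral) auto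
  finally show ?thesis .
qed

lemma chi_cong: "(\<And>x. x \<in> R \<Longrightarrow> \<eta> x = \<zeta> x) \<Longrightarrow> chi R \<eta> = chi R \<zeta>"
  unfolding chi_def by (intro prod.cong) auto

lemma infsum_Union_le:
  fixes f :: "'a \<Rightarrow> real"
  assumes "finite D" and "\<And>x. x \<in> D \<Longrightarrow> f summable_on B x" and "\<And>x. f x \<ge> 0"
  shows "f summable_on (\<Union>x\<in>D. B x) \<and> infsum f (\<Union>x\<in>D. B x) \<le> (\<Sum>x\<in>D. infsum f (B x))"
  using assms(1,2)
proof (induction D)
  case (insert x D)
  let ?U = "\<Union>x\<in>D. B x"
  have IH: "f summable_on ?U" "infsum f ?U \<le> (\<Sum>x\<in>D. infsum f (B x))" using insert by auto
  have sx: "f summable_on B x" using insert by auto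
  have sd: "f summable_on (?U - B x)" using IH(1) by (rule summable_on_subset) auto
  have "infsum f (B x \<union> (?U - B x)) = infsum f (B x) + infsum f (?U - B x)"
    by (rule infsum_Un_disjoint[OF sx sd]) auto
  also have "infsum f (?U - B x) \<le> infsum f ?U"
    by (rule infsum_mono2[OF sd IH(1)]) (auto simp: assms(3))
  finally have "infsum f (B x \<union> ?U) \<le> infsum f (B x) + infsum f ?U" by simp
  then show ?case using IH insert summable_on_union[OF sx IH(1)] by simp
qed simp

locale decaying_potential =
  fixes J :: "int set \<Rightarrow> real"
  assumes summable: "\<And>x. (\<lambda>R. \<bar>J R\<bar>) summable_on {R. finite R \<and> x \<in> R}"
    and invariant: "\<And>R k. finite R \<Longrightarrow> card R \<ge> 2 \<Longrightarrow> J ((\<lambda>x. x + k) ` R) = J R"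
    and right_fast: "(\<lambda>x. exp (2 * J {x})) summable_on {1..}"
    and left_fast: "(\<lambda>x. exp (- 2 * J {x})) summable_on {..0}"
begin

definition relative_energy :: "config \<Rightarrow> real" where
  "relative_energy \<eta> = (\<Sum>\<^sub>\<infinity>R\<in>{R. finite R}. J R * (chi R \<eta> - chi R heaviside))"

lemma summable_meeting:
  assumes "finite E" shows "(\<lambda>R. J R * chi R \<eta>) summable_on {R. finite R \<and> R \<inter> E \<noteq> {}}"
proof -
  have "{R. finite R \<and> R \<inter> E \<noteq> {}} = (\<Union>x\<in>E. {R. finite R \<and> x \<in> R})" by auto
  then have "(\<lambda>R. \<bar>J R\<bar>) summable_on {R. finite R \<and> R \<inter> E \<noteq> {}}"
    using infsum_Union_le[OF assms summable] by simp
  then have "(\<lambda>R. norm (J R * chi R \<eta>)) summable_on {R. finite R \<and> R \<inter> E \<noteq> {}}"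
    by (simp add: abs_mult)
  then show ?thesis by (rule abs_summable_summable)
qed

text \<open>The left-hand series runs over all finite sets, whereas the separate energies converge only over
  the sets meeting \<open>E\<close>; the remaining sets do not see where \<open>\<eta>\<close> and \<open>\<zeta>\<close> differ.\<close>

lemma energy_difference:
  assumes "finite E" and "\<And>x. x \<notin> E \<Longrightarrow> \<eta> x = \<zeta> x"
  shows "((\<lambda>R. J R * (chi R \<eta> - chi R \<zeta>)) has_sum
     ((\<Sum>\<^sub>\<infinity>R\<in>{R. finite R \<and> R \<inter> E \<noteq> {}}. J R * chi R \<eta>) -
      (\<Sum>\<^sub>\<infinity>R\<in>{R. finite R \<and> R \<inter> E \<noteq> {}}. J R * chi R \<zeta>))) {R. finite R}"
proof -
  let ?M = "{R. finite R \<and> R \<inter> E \<noteq> {}}"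
  have "((\<lambda>R. J R * chi R \<eta> + - (J R * chi R \<zeta>)) has_sum
     ((\<Sum>\<^sub>\<infinity>R\<in>?M. J R * chi R \<eta>) + - (\<Sum>\<^sub>\<infinity>R\<in>?M. J R * chi R \<zeta>))) ?M"
    by (intro has_sum_add has_sum_uminusI has_sum_infsum summable_meeting assms)
  then have "((\<lambda>R. J R * (chi R \<eta> - chi R \<zeta>)) has_sum
     ((\<Sum>\<^sub>\<infinity>R\<in>?M. J R * chi R \<eta>) - (\<Sum>\<^sub>\<infinity>R\<in>?M. J R * chi R \<zeta>))) ?M"
    by (simp add: algebra_simps)
  moreover have "chi R \<eta> = chi R \<zeta>" if "R \<inter> E = {}" for R
    using that assms(2) by (intro chi_cong) auto
  ultimately show ?thesis
    by (subst has_sum_cong_neutral[where g = "\<lambda>R. J R * (chi R \<eta> - chi R \<zeta>)" and T = ?M]) auto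
qed

lemma relative_energy_difference:
  assumes "\<eta> \<in> blocking_configs" and "finite E" and "\<And>x. x \<notin> E \<Longrightarrow> \<eta> x = \<zeta> x"
  shows "relative_energy \<zeta> - relative_energy \<eta> =
     (\<Sum>\<^sub>\<infinity>R\<in>{R. finite R \<and> R \<inter> E \<noteq> {}}. J R * chi R \<zeta>) -
     (\<Sum>\<^sub>\<infinity>R\<in>{R. finite R \<and> R \<inter> E \<noteq> {}}. J R * chi R \<eta>)"
proof -
  have fin: "finite {x. \<eta> x \<noteq> heaviside x}" using assms(1) by (simp add: blocking_configs_eq)
  have "((\<lambda>R. J R * (chi R \<eta> - chi R heaviside)) has_sum relative_energy \<eta>) {R. finite R}"
    unfolding relative_energy_def
    by (intro has_sum_infsum has_sum_imp_summable[OF energy_difference[OF fin]]) auto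
  moreover have "((\<lambda>R. J R * (chi R \<zeta> - chi R \<eta>)) has_sum
     ((\<Sum>\<^sub>\<infinity>R\<in>{R. finite R \<and> R \<inter> E \<noteq> {}}. J R * chi R \<zeta>) -
      (\<Sum>\<^sub>\<infinity>R\<in>{R. finite R \<and> R \<inter> E \<noteq> {}}. J R * chi R \<eta>))) {R. finite R}" (is "(_ has_sum ?d) _")
    using assms by (intro energy_difference) auto
  ultimately have "((\<lambda>R. J R * (chi R \<eta> - chi R heaviside) + J R * (chi R \<zeta> - chi R \<eta>)) has_sum
      (relative_energy \<eta> + ?d)) {R. finite R}" by (rule has_sum_add)
  then have "relative_energy \<zeta> = relative_energy \<eta> + ?d"
    unfolding relative_energy_def by (intro infsumI) (simp add: algebra_simps)
  then show ?thesis by simp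
qed

text \<open>The additive constant cancels in the Gibbs measure, so a single weight serves all boxes.\<close>

lemma energy_eq_relative_energy:
  "energy J N \<eta> = relative_energy (extend N \<eta>) + energy J N heaviside"
proof -
  have ext: "extend N heaviside = heaviside" by (auto simp: extend_def)
  have "relative_energy (extend N \<eta>) - relative_energy heaviside =
     (\<Sum>\<^sub>\<infinity>R\<in>{R. finite R \<and> R \<inter> box N \<noteq> {}}. J R * chi R (extend N \<eta>)) -
     (\<Sum>\<^sub>\<infinity>R\<in>{R. finite R \<and> R \<inter> box N \<noteq> {}}. J R * chi R heaviside)"
    by (rule relative_energy_difference) (auto simp: blocking_configs_eq box_def extend_def)
  then show ?thesis by (simp add: energy_def ext relative_energy_def)
qed

lemma relative_energy_exchange:
  assumes "\<eta> \<in> blocking_configs"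
  shows "relative_energy (exchange x y \<eta>) - relative_energy \<eta> =
     local_energy J x y (exchange x y \<eta>) - local_energy J x y \<eta>"
proof -
  have "{R. finite R \<and> R \<inter> {x, y} \<noteq> {}} = {R. finite R \<and> (x \<in> R \<or> y \<in> R)}" by auto
  then show ?thesis
    using relative_energy_difference[OF assms, of "{x, y}" "exchange x y \<eta>"]
    by (auto simp: local_energy_def exchange_off)
qed


section \<open>Summability of the Boltzmann weights\<close>

text \<open>The site \<open>0\<close> stands for any site, by translation invariance.\<close>

definition interaction :: real where
  "interaction = (\<Sum>\<^sub>\<infinity>R\<in>{R. finite R \<and> 2 \<le> card R \<and> 0 \<in> R}. \<bar>J R\<bar>)"

text \<open>An upper bound for the factor by which a defect at \<open>x\<close> multiplies the Boltzmann weight.\<close>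

definition defect_weight :: "int \<Rightarrow> real" where
  "defect_weight x = exp (2 * interaction) * exp (if x \<ge> 1 then 2 * J {x} else - 2 * J {x})"

lemma summable_interaction: "(\<lambda>R. \<bar>J R\<bar>) summable_on {R. finite R \<and> 2 \<le> card R \<and> x \<in> R}"
  by (rule summable_on_subset[OF summable[of x]]) auto

lemma interaction_eq: "(\<Sum>\<^sub>\<infinity>R\<in>{R. finite R \<and> 2 \<le> card R \<and> x \<in> R}. \<bar>J R\<bar>) = interaction"
  unfolding interaction_def
  by (rule infsum_reindex_bij_witness[where i = "\<lambda>R. (\<lambda>z. z + x) ` R" and j = "\<lambda>R. (\<lambda>z. z + - x) ` R"])
     (auto simp: image_image card_image invariant intro: rev_image_eqI simp del: add_uminus_conv_diff)

lemma summable_defect_weight: "defect_weight summable_on UNIV"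
proof -
  let ?f = "\<lambda>x. exp (if x \<ge> 1 then 2 * J {x} else - 2 * J {x})"
  have "?f summable_on {1..}"
    by (rule summable_on_cong[THEN iffD2, OF _ right_fast]) simp
  moreover have "?f summable_on {..0}"
    by (rule summable_on_cong[THEN iffD2, OF _ left_fast]) simp
  ultimately have "?f summable_on {1..} \<union> {..0}"
    by (rule summable_on_Un_disjoint) auto
  moreover have "{1..} \<union> {..0} = (UNIV :: int set)" by auto
  ultimately show ?thesis
    unfolding defect_weight_def by (intro summable_on_cmult_right) simp
qed

text \<open>Each single-site term is computed exactly; every set with at least two points that meets
  the defects costs at most \<open>2 \<bar>J R\<bar>\<close>, and translation invariance makes the total per defect
  independent of where the defect is.\<close>

lemma exp_relative_energy_le:
  assumes "\<eta> \<in> blocking_configs"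
  shows "exp (- relative_energy \<eta>) \<le> (\<Prod>x\<in>{x. \<eta> x \<noteq> heaviside x}. defect_weight x)"
proof -
  define D where "D = {x. \<eta> x \<noteq> heaviside x}"
  have fin: "finite D" using assms by (simp add: blocking_configs_eq D_def)
  define F where "F R = J R * (chi R \<eta> - chi R heaviside)" for R
  have F0: "F R = 0" if "R \<inter> D = {}" for R
  proof -
    have "chi R \<eta> = chi R heaviside" using that by (intro chi_cong) (auto simp: D_def)
    then show ?thesis by (simp add: F_def)
  qed
  have summF: "F summable_on {R. finite R}"
    unfolding F_def
    by (rule has_sum_imp_summable[OF energy_difference[OF fin]]) (simp add: D_def)
  let ?S = "(\<lambda>x. {x}) ` D" and ?M = "\<Union>x\<in>D. {R. finite R \<and> 2 \<le> card R \<and> x \<in> R}"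
  have sumS: "infsum F ?S = (\<Sum>x\<in>D. if x \<ge> 1 then - 2 * J {x} else 2 * J {x})"
  proof -
    have "infsum F ?S = (\<Sum>x\<in>D. F {x})"
      using fin by (simp add: sum.reindex)
    also have "\<dots> = (\<Sum>x\<in>D. if x \<ge> 1 then - 2 * J {x} else 2 * J {x})"
      by (intro sum.cong) (auto simp: F_def chi_def D_def heaviside_def)
    finally show ?thesis .
  qed
  have U: "(\<lambda>R. \<bar>J R\<bar>) summable_on ?M \<and> infsum (\<lambda>R. \<bar>J R\<bar>) ?M \<le> (\<Sum>x\<in>D. interaction)"
    using infsum_Union_le[OF fin summable_interaction] by (simp add: interaction_eq)
  have absF: "\<bar>F R\<bar> \<le> 2 * \<bar>J R\<bar>" for R
  proof -
    have "\<bar>chi R \<eta> - chi R heaviside\<bar> \<le> 2"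
      using abs_triangle_ineq4[of "chi R \<eta>" "chi R heaviside"] by simp
    then show ?thesis unfolding F_def abs_mult by (metis abs_ge_zero mult.commute mult_left_mono)
  qed
  have sM: "F summable_on ?M" by (rule summable_on_subset[OF summF]) auto
  have sS: "F summable_on ?S" using fin by simp
  have "relative_energy \<eta> = infsum F {R. finite R}"
    unfolding relative_energy_def F_def ..
  also have "\<dots> = infsum F (?S \<union> ?M)"
  proof (rule infsum_cong_neutral)
    fix R assume R: "R \<in> {R. finite R} - (?S \<union> ?M)"
    show "F R = 0"
    proof (rule F0, rule ccontr)
      assume "R \<inter> D \<noteq> {}"
      then obtain x where x: "x \<in> R" "x \<in> D" by auto
      with R have "card R < 2" "finite R" "card R \<noteq> 0" by auto
      then have "card R = 1" by linarith
      then obtain z where "R = {z}" by (auto simp: card_1_singleton_iff)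
      with x R show False by auto
    qed
  qed auto
  also have "\<dots> = infsum F ?S + infsum F ?M"
    by (rule infsum_Un_disjoint[OF sS sM]) auto
  finally have 1: "relative_energy \<eta> = infsum F ?S + infsum F ?M" .
  have "- infsum F ?M = infsum (\<lambda>R. - F R) ?M" by (simp add: infsum_uminus)
  also have "\<dots> \<le> infsum (\<lambda>R. 2 * \<bar>J R\<bar>) ?M"
  proof (rule infsum_mono)
    fix R show "- F R \<le> 2 * \<bar>J R\<bar>" using absF[of R] by linarith
  qed (use sM U in \<open>auto intro: summable_on_cmult_right simp: summable_on_uminus\<close>)
  also have "\<dots> = 2 * infsum (\<lambda>R. \<bar>J R\<bar>) ?M"
    by (rule infsum_cmult_right) (use U in blast)
  also have "\<dots> \<le> (\<Sum>x\<in>D. 2 * interaction)" using U by (simp add: sum_distrib_left[symmetric])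
  finally have "- relative_energy \<eta> \<le>
      (\<Sum>x\<in>D. 2 * interaction) - (\<Sum>x\<in>D. if x \<ge> 1 then - 2 * J {x} else 2 * J {x})"
    using 1 sumS by linarith
  also have "\<dots> = (\<Sum>x\<in>D. 2 * interaction + (if x \<ge> 1 then 2 * J {x} else - 2 * J {x}))"
    unfolding sum_subtractf[symmetric] by (rule sum.cong) auto
  finally have "exp (- relative_energy \<eta>) \<le>
      exp (\<Sum>x\<in>D. 2 * interaction + (if x \<ge> 1 then 2 * J {x} else - 2 * J {x}))" by simp
  also have "\<dots> = (\<Prod>x\<in>D. defect_weight x)"
    unfolding defect_weight_def exp_sum[OF fin] exp_add by simp
  finally show ?thesis by (simp add: D_def)
qed

text \<open>A blocking configuration is determined by its defect set. Enlarging a finite family of defect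
  sets to the full power set of their union makes the sum of products factorize.\<close>

lemma summable_weights: "(\<lambda>\<eta>. exp (- relative_energy \<eta>)) summable_on blocking_configs"
proof (rule nonneg_bounded_partial_sums_imp_summable_on
    [where C = "exp (infsum defect_weight UNIV)"])
  have pos: "defect_weight x \<ge> 0" for x by (simp add: defect_weight_def)
  show "eventually (\<lambda>F. sum (\<lambda>\<eta>. exp (- relative_energy \<eta>)) F \<le> exp (infsum defect_weight UNIV))
     (finite_subsets_at_top blocking_configs)"
  proof (rule eventually_finite_subsets_at_top_weakI)
    fix F assume F: "finite F" "F \<subseteq> blocking_configs"
    define S where "S = (\<lambda>\<eta>. {x. \<eta> x \<noteq> heaviside x})"
    define U where "U = \<Union>(S ` F)"
    have finU: "finite U" using F by (auto simp: U_def S_def blocking_configs_eq)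
    have inj: "inj_on S F" by (rule inj_onI) (auto simp: S_def set_eq_iff fun_eq_iff)
    have "sum (\<lambda>\<eta>. exp (- relative_energy \<eta>)) F \<le> (\<Sum>\<eta>\<in>F. \<Prod>x\<in>S \<eta>. defect_weight x)"
      unfolding S_def using F by (intro sum_mono exp_relative_energy_le) auto
    also have "\<dots> = (\<Sum>D\<in>S ` F. \<Prod>x\<in>D. defect_weight x)"
      using inj by (simp add: sum.reindex)
    also have "\<dots> \<le> (\<Sum>D\<in>Pow U. \<Prod>x\<in>D. defect_weight x)"
      using finU pos by (intro sum_mono2) (auto simp: U_def intro!: prod_nonneg)
    also have "\<dots> = (\<Prod>x\<in>U. defect_weight x + 1)"
      using prod_add[OF finU, of defect_weight "\<lambda>_. 1"] by simp
    also have "\<dots> \<le> (\<Prod>x\<in>U. exp (defect_weight x))"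
      using pos by (intro prod_mono) (auto simp: add.commute intro: add_nonneg_nonneg)
    also have "\<dots> = exp (\<Sum>x\<in>U. defect_weight x)" by (simp add: exp_sum finU)
    also have "\<dots> \<le> exp (infsum defect_weight UNIV)"
      using finU pos by (simp add: finite_sum_le_infsum[OF summable_defect_weight])
    finally show "sum (\<lambda>\<eta>. exp (- relative_energy \<eta>)) F \<le> exp (infsum defect_weight UNIV)" .
  qed
qed auto

end

context decaying_potential
begin

section \<open>The infinite-volume Gibbs measure\<close>

definition weight :: "config \<Rightarrow> real" where
  "weight \<eta> = exp (- relative_energy \<eta>)"

definition total_weight :: real where
  "total_weight = infsum weight blocking_configs"

lemma weight_pos: "weight \<eta> > 0"
  by (simp add: weight_def)

lemma weight_summable: "weight summable_on blocking_configs"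
  unfolding weight_def by (rule summable_weights)

lemma heaviside_in_blocking: "heaviside \<in> blocking_configs"
  by (simp add: blocking_configs_eq)

lemma total_weight_pos: "total_weight > 0"
proof -
  have "sum weight {heaviside} \<le> total_weight"
    unfolding total_weight_def using weight_summable heaviside_in_blocking
    by (intro finite_sum_le_infsum) (auto intro: less_imp_le weight_pos)
  with weight_pos[of heaviside] show ?thesis by simp
qed

definition gibbs_pmf :: "config pmf" where
  "gibbs_pmf = embed_pmf (\<lambda>\<eta>. if \<eta> \<in> blocking_configs then weight \<eta> / total_weight else 0)"

lemma pmf_gibbs_pmf: "pmf gibbs_pmf \<eta> = (if \<eta> \<in> blocking_configs then weight \<eta> / total_weight else 0)"
proof -
  let ?f = "\<lambda>\<eta>. if \<eta> \<in> blocking_configs then weight \<eta> / total_weight else 0"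
  have "(\<integral>\<^sup>+\<eta>. ennreal (?f \<eta>) \<partial>count_space UNIV) =
      (\<integral>\<^sup>+\<eta>. ennreal (weight \<eta> / total_weight) \<partial>count_space blocking_configs)"
    by (subst nn_integral_count_space_indicator, simp)
       (auto intro!: nn_integral_cong split: split_indicator)
  also have "\<dots> = ennreal (infsum (\<lambda>\<eta>. weight \<eta> / total_weight) blocking_configs)"
    using weight_summable total_weight_pos weight_pos
    by (intro nn_integral_count_space_eq_infsum)
       (auto simp: divide_inverse intro: less_imp_le summable_on_cmult_left)
  also have "infsum (\<lambda>\<eta>. weight \<eta> / total_weight) blocking_configs = 1"
    using total_weight_pos by (simp add: divide_inverse infsum_cmult_left' total_weight_def[symmetric])
  finally have "(\<integral>\<^sup>+\<eta>. ennreal (?f \<eta>) \<partial>count_space UNIV) = 1" by simp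
  moreover have "0 \<le> ?f \<eta>" for \<eta>
    using total_weight_pos weight_pos[of \<eta>] by simp
  ultimately show ?thesis
    unfolding gibbs_pmf_def by (intro pmf_embed_pmf[where f = ?f])
qed

definition gibbs_limit :: "config measure" where
  "gibbs_limit = distr (measure_pmf gibbs_pmf) borel (\<lambda>\<eta>. \<eta>)"

lemma integral_gibbs_limit:
  fixes f :: "config \<Rightarrow> real"
  assumes "f \<in> borel_measurable borel"
  shows "(\<integral>\<eta>. f \<eta> \<partial>gibbs_limit) = measure_pmf.expectation gibbs_pmf f"
  unfolding gibbs_limit_def by (subst integral_distr[OF _ assms]) simp_all

lemma blocking_gibbs_limit: "blocking_measure gibbs_limit"
proof -
  have "AE \<eta> in measure_pmf gibbs_pmf. \<eta> \<in> blocking_configs"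
    by (auto simp: AE_measure_pmf_iff set_pmf_iff pmf_gibbs_pmf split: if_splits)
  then show ?thesis
    unfolding blocking_measure_def gibbs_limit_def
    by (subst AE_distr_iff)
       (auto intro!: measure_pmf.prob_space_distr
         countable_config_borel countable_blocking_configs)
qed


section \<open>Convergence of the finite-volume Gibbs measures\<close>

definition box_perturbations :: "nat \<Rightarrow> config set" where
  "box_perturbations N = extend N ` box_configs N"

lemma box_perturbations_iff:
  "\<eta> \<in> box_perturbations N \<longleftrightarrow> {x. \<eta> x \<noteq> heaviside x} \<subseteq> box N"
proof
  assume "{x. \<eta> x \<noteq> heaviside x} \<subseteq> box N"
  then have "\<eta> = extend N (restrict \<eta> (box N))" by (auto simp: extend_def fun_eq_iff)
  then show "\<eta> \<in> box_perturbations N"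
    unfolding box_perturbations_def box_configs_def by (rule image_eqI[where f = "extend N"]) auto
qed (auto simp: box_perturbations_def extend_def split: if_splits)

lemma inj_on_extend: "inj_on (extend N) (box_configs N)"
proof (rule inj_onI)
  fix \<eta> \<zeta> assume mem: "\<eta> \<in> box_configs N" "\<zeta> \<in> box_configs N"
    and eq: "extend N \<eta> = extend N \<zeta>"
  show "\<eta> = \<zeta>"
  proof (rule PiE_ext[OF mem[unfolded box_configs_def]])
    fix x assume "x \<in> box N"
    then show "\<eta> x = \<zeta> x" using fun_cong[OF eq, of x] by (simp add: extend_def)
  qed
qed

lemma finite_box_configs: "finite (box_configs N)"
  unfolding box_configs_def box_def by (intro finite_PiE) auto

lemma filterlim_box_perturbations:
  "filterlim box_perturbations (finite_subsets_at_top blocking_configs) sequentially"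
  unfolding filterlim_finite_subsets_at_top
proof (intro allI impI)
  fix F assume F: "finite F \<and> F \<subseteq> blocking_configs"
  define U where "U = (\<Union>\<eta>\<in>F. {x. \<eta> x \<noteq> heaviside x})"
  have "finite U" using F by (auto simp: U_def blocking_configs_eq)
  then obtain K where K: "\<And>x. x \<in> U \<Longrightarrow> \<bar>x\<bar> \<le> K"
    by (metis finite_imageI abs_ge_zero bdd_above_finite bdd_above.E imageI)
  show "\<forall>\<^sub>F N in sequentially. finite (box_perturbations N) \<and> F \<subseteq> box_perturbations N \<and>
      box_perturbations N \<subseteq> blocking_configs"
    using eventually_ge_at_top[of "nat (K + 1)"]
  proof eventually_elim
    case (elim N)
    have "U \<subseteq> box N" using K elim by (fastforce simp: box_def)
    then have "F \<subseteq> box_perturbations N"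
      unfolding U_def UN_subset_iff by (simp only: box_perturbations_iff subset_iff) simp
    moreover have "finite (box_perturbations N)"
      unfolding box_perturbations_def using finite_box_configs by (rule finite_imageI)
    moreover have "box_perturbations N \<subseteq> blocking_configs"
    proof
      fix \<eta> assume "\<eta> \<in> box_perturbations N"
      then have "{x. \<eta> x \<noteq> heaviside x} \<subseteq> box N" by (simp only: box_perturbations_iff)
      then have "finite {x. \<eta> x \<noteq> heaviside x}"
        by (rule finite_subset) (simp add: box_def)
      then show "\<eta> \<in> blocking_configs" by (simp add: blocking_configs_eq)
    qed
    ultimately show ?case by simp
  qed
qed

lemma integral_gibbs:
  fixes f :: "config \<Rightarrow> real"
  assumes f: "f \<in> borel_measurable borel"
  shows "(\<integral>\<eta>. f \<eta> \<partial>gibbs J N) =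
    (\<Sum>\<eta>\<in>box_perturbations N. weight \<eta> * f \<eta>) / (\<Sum>\<eta>\<in>box_perturbations N. weight \<eta>)"
proof -
  define c where "c = exp (- energy J N heaviside)"
  have exp_eq: "exp (- energy J N \<eta>) = c * weight (extend N \<eta>)" for \<eta>
    unfolding energy_eq_relative_energy[of N \<eta>] c_def weight_def by (simp add: exp_add[symmetric])
  have sum_eq: "(\<Sum>\<eta>\<in>box_configs N. g (extend N \<eta>)) = (\<Sum>\<eta>\<in>box_perturbations N. g \<eta>)"
    for g :: "config \<Rightarrow> real"
    unfolding box_perturbations_def using inj_on_extend by (simp add: sum.reindex)
  have pf: "partition_function J N = c * (\<Sum>\<eta>\<in>box_perturbations N. weight \<eta>)"
    unfolding partition_function_def exp_eq sum_distrib_left[symmetric] sum_eq[of weight] ..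
  have c: "c \<noteq> 0" by (simp add: c_def)
  have pf_nonneg: "partition_function J N \<ge> 0"
    unfolding partition_function_def by (intro sum_nonneg) auto
  have "(\<integral>\<eta>. f \<eta> \<partial>gibbs J N) = (\<integral>\<eta>. f (extend N \<eta>) \<partial>gibbs_box J N)"
    unfolding gibbs_def gibbs_box_def
    by (rule integral_distr) (use f in \<open>auto simp: measurable_point_measure_eq1\<close>)
  also have "\<dots> = (\<Sum>\<eta>\<in>box_configs N. exp (- energy J N \<eta>) / partition_function J N * f (extend N \<eta>))"
    unfolding gibbs_box_def
    by (subst lebesgue_integral_point_measure_finite) (use finite_box_configs pf_nonneg in auto)
  also have "\<dots> = (\<Sum>\<eta>\<in>box_configs N. weight (extend N \<eta>) * f (extend N \<eta>) /
      (\<Sum>\<eta>\<in>box_perturbations N. weight \<eta>))"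
    using c by (simp add: exp_eq pf)
  also have "\<dots> = (\<Sum>\<eta>\<in>box_perturbations N. weight \<eta> * f \<eta> / (\<Sum>\<eta>\<in>box_perturbations N. weight \<eta>))"
    by (rule sum_eq[of "\<lambda>\<eta>. weight \<eta> * f \<eta> / (\<Sum>\<eta>\<in>box_perturbations N. weight \<eta>)"])
  finally show ?thesis by (simp add: sum_divide_distrib)
qed

text \<open>Numerator and denominator are partial sums, along an exhausting sequence of finite sets, of
  absolutely convergent series over the blocking configurations.\<close>

lemma gibbs_converges: "converges_weakly (gibbs J) gibbs_limit"
  unfolding converges_weakly_def
proof (intro allI impI)
  fix f :: "config \<Rightarrow> real"
  assume f: "continuous_on UNIV f \<and> bounded (range f)"
  then have meas: "f \<in> borel_measurable borel" by (simp add: borel_measurable_continuous_onI)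
  obtain B where B: "\<And>\<eta>. \<bar>f \<eta>\<bar> \<le> B" using f by (auto simp: bounded_iff)
  let ?X = "blocking_configs"
  have sum_wf: "(\<lambda>\<eta>. norm (weight \<eta> * f \<eta>)) summable_on ?X"
  proof (rule summable_on_comparison_test)
    show "(\<lambda>\<eta>. weight \<eta> * B) summable_on ?X"
      by (rule summable_on_cmult_left) (rule weight_summable)
    show "norm (weight \<eta> * f \<eta>) \<le> weight \<eta> * B" for \<eta>
      using B[of \<eta>] weight_pos[of \<eta>] by (simp add: abs_mult)
  qed simp
  have "(\<lambda>N. (\<Sum>\<eta>\<in>box_perturbations N. weight \<eta> * f \<eta>) / (\<Sum>\<eta>\<in>box_perturbations N. weight \<eta>))
    \<longlonglongrightarrow> infsum (\<lambda>\<eta>. weight \<eta> * f \<eta>) ?X / total_weight"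
    using total_weight_pos weight_summable abs_summable_summable[OF sum_wf] unfolding total_weight_def
    by (intro tendsto_divide filterlim_compose[OF infsum_tendsto filterlim_box_perturbations]) auto
  moreover have "(\<integral>\<eta>. f \<eta> \<partial>gibbs_limit) = infsum (\<lambda>\<eta>. weight \<eta> * f \<eta>) ?X / total_weight"
  proof -
    have "(\<integral>\<eta>. f \<eta> \<partial>gibbs_limit) = (\<integral>\<eta>. pmf gibbs_pmf \<eta> * f \<eta> \<partial>count_space UNIV)"
      unfolding integral_gibbs_limit[OF meas] measure_pmf_eq_density
      by (subst integral_density) auto
    also have "\<dots> = infsetsum (\<lambda>\<eta>. pmf gibbs_pmf \<eta> * f \<eta>) UNIV"
      by (simp add: infsetsum_def)
    also have "\<dots> = infsetsum (\<lambda>\<eta>. weight \<eta> * f \<eta> * inverse total_weight) ?X"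
      by (rule infsetsum_cong_neutral) (auto simp: pmf_gibbs_pmf divide_inverse)
    also have "\<dots> = infsum (\<lambda>\<eta>. weight \<eta> * f \<eta> * inverse total_weight) ?X"
      using summable_on_cmult_left[OF sum_wf, of "\<bar>inverse total_weight\<bar>"]
      by (intro infsetsum_infsum) (simp add: abs_summable_equivalent[symmetric] abs_mult)
    finally show ?thesis by (simp add: infsum_cmult_left' divide_inverse)
  qed
  ultimately show "(\<lambda>N. \<integral>\<eta>. f \<eta> \<partial>gibbs J N) \<longlonglongrightarrow> (\<integral>\<eta>. f \<eta> \<partial>gibbs_limit)"
    by (simp add: integral_gibbs[OF meas])
qed

end


section \<open>Jump kernels and their time reversal\<close>

lemma borel_measurable_nn_integral_count_space:
  assumes "countable X" and "\<And>\<xi>. \<xi> \<in> X \<Longrightarrow> f \<xi> \<in> borel_measurable M"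
  shows "(\<lambda>t. \<integral>\<^sup>+\<xi>. f \<xi> t \<partial>count_space X) \<in> borel_measurable M"
proof -
  interpret sigma_finite_measure "count_space X"
    using assms(1) by (rule sigma_finite_measure_count_space_countable)
  have "(\<lambda>p. f (snd p) (fst p)) \<in> borel_measurable (M \<Otimes>\<^sub>M count_space X)"
    by (rule measurable_compose_countable'[where f = "\<lambda>\<xi> p. f \<xi> (fst p)" and g = snd])
       (use assms in auto)
  then show ?thesis
    by (intro borel_measurable_nn_integral) (simp add: case_prod_unfold)
qed

lemma nn_integral_count_space_point:
  assumes "\<eta> \<in> X"
  shows "(\<integral>\<^sup>+\<xi>. (if \<eta> = \<xi> then f \<xi> else 0) \<partial>count_space X) = (f \<eta> :: ennreal)"
proof -
  have "(\<integral>\<^sup>+\<xi>. (if \<eta> = \<xi> then f \<xi> else 0) \<partial>count_space X) =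
      (\<integral>\<^sup>+\<xi>. f \<eta> * indicator {\<eta>} \<xi> \<partial>count_space X)"
    by (intro nn_integral_cong) auto
  also have "\<dots> = f \<eta>"
    using assms by (subst nn_integral_cmult_indicator) auto
  finally show ?thesis .
qed

text \<open>Commutativity of convolution, with the middle factor held fixed: for each \<open>v\<close> the reflection
  \<open>u \<mapsto> t + v - u\<close> exchanges the roles of \<open>u - v\<close> and \<open>t - u\<close>.\<close>

lemma convolution_swap:
  fixes A B C :: "real \<Rightarrow> ennreal"
  assumes [measurable]: "A \<in> borel_measurable borel" "B \<in> borel_measurable borel"
    "C \<in> borel_measurable borel"
  shows "(\<integral>\<^sup>+u. \<integral>\<^sup>+v. A (u - v) * B v * C (t - u) \<partial>lborel \<partial>lborel) =
    (\<integral>\<^sup>+u. \<integral>\<^sup>+v. A (t - u) * B v * C (u - v) \<partial>lborel \<partial>lborel)"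
proof -
  have "(\<integral>\<^sup>+u. \<integral>\<^sup>+v. A (u - v) * B v * C (t - u) \<partial>lborel \<partial>lborel) =
      (\<integral>\<^sup>+v. \<integral>\<^sup>+u. A (u - v) * B v * C (t - u) \<partial>lborel \<partial>lborel)"
    by (rule lborel_pair.Fubini') measurable
  also have "\<dots> = (\<integral>\<^sup>+v. \<integral>\<^sup>+u. A (t - u) * B v * C (u - v) \<partial>lborel \<partial>lborel)"
  proof (rule nn_integral_cong)
    fix v :: real
    show "(\<integral>\<^sup>+u. A (u - v) * B v * C (t - u) \<partial>lborel) = (\<integral>\<^sup>+u. A (t - u) * B v * C (u - v) \<partial>lborel)"
      by (subst nn_integral_real_affine[where c = "-1" and t = "t + v"]) (auto simp: algebra_simps)
  qed
  also have "\<dots> = (\<integral>\<^sup>+u. \<integral>\<^sup>+v. A (t - u) * B v * C (u - v) \<partial>lborel \<partial>lborel)"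
    by (rule lborel_pair.Fubini'[symmetric]) measurable
  finally show ?thesis .
qed

text \<open>The tail of the exponential law with parameter \<open>r\<close>, set to \<open>0\<close> at negative times so that
  convolutions over \<open>[0, t]\<close> become integrals over the line.\<close>

definition survival :: "real \<Rightarrow> real \<Rightarrow> ennreal" where
  "survival r s = (if 0 \<le> s then ennreal (exp (- r * s)) else 0)"

lemma survival_measurable [measurable]: "survival r \<in> borel_measurable borel"
  unfolding survival_def by measurable

locale jump_kernel =
  fixes X :: "'a set" and q :: "'a \<Rightarrow> 'a \<Rightarrow> ennreal" and r :: "'a \<Rightarrow> real"
  assumes countable_X: "countable X"
begin

text \<open>The probability that the chain with jump rates \<open>q\<close> and exit rates \<open>r\<close>, started from \<open>\<eta>\<close>, is at
  \<open>\<zeta>\<close> at time \<open>t\<close> after exactly \<open>n\<close> jumps. The recursion splits according to the time \<open>u\<close> of the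
  last jump and the state \<open>\<xi>\<close> before it.\<close>

primrec kernel :: "nat \<Rightarrow> 'a \<Rightarrow> 'a \<Rightarrow> real \<Rightarrow> ennreal" where
  "kernel 0 \<eta> \<zeta> t = (if \<eta> = \<zeta> then survival (r \<eta>) t else 0)"
| "kernel (Suc n) \<eta> \<zeta> t =
     (\<integral>\<^sup>+\<xi>. \<integral>\<^sup>+u. kernel n \<eta> \<xi> u * (q \<xi> \<zeta> * survival (r \<zeta>) (t - u)) \<partial>lborel \<partial>count_space X)"

lemma kernel_measurable [measurable]: "kernel n \<eta> \<zeta> \<in> borel_measurable borel"
proof (induction n arbitrary: \<zeta>)
  case 0
  then show ?case by (cases "\<eta> = \<zeta>") simp_all
next
  case (Suc n)
  note Suc[measurable]
  show ?case
    unfolding kernel.simps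
    by (rule borel_measurable_nn_integral_count_space[OF countable_X]) measurable
qed

text \<open>The same probability split at the first jump. In the induction step the first and the last
  holding time trade places by \<open>convolution_swap\<close>.\<close>

lemma kernel_backward:
  assumes "\<eta> \<in> X" and "\<zeta> \<in> X"
  shows "kernel (Suc n) \<eta> \<zeta> t =
    (\<integral>\<^sup>+\<kappa>. \<integral>\<^sup>+u. survival (r \<eta>) (t - u) * (q \<eta> \<kappa> * kernel n \<kappa> \<zeta> u) \<partial>lborel \<partial>count_space X)"
  using assms(2)
proof (induction n arbitrary: \<zeta> t)
  case 0
  have "kernel (Suc 0) \<eta> \<zeta> t = (\<integral>\<^sup>+\<xi>. (if \<eta> = \<xi> then
      \<integral>\<^sup>+u. survival (r \<eta>) u * (q \<xi> \<zeta> * survival (r \<zeta>) (t - u)) \<partial>lborel else 0) \<partial>count_space X)"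
    unfolding kernel.simps by (intro nn_integral_cong) auto
  also have "\<dots> = (\<integral>\<^sup>+u. survival (r \<eta>) u * (q \<eta> \<zeta> * survival (r \<zeta>) (t - u)) \<partial>lborel)"
    using assms(1) by (rule nn_integral_count_space_point)
  also have "\<dots> = (\<integral>\<^sup>+u. survival (r \<eta>) (t - u) * (q \<eta> \<zeta> * survival (r \<zeta>) u) \<partial>lborel)"
    by (subst nn_integral_real_affine[where c = "-1" and t = t]) auto
  also have "\<dots> = (\<integral>\<^sup>+\<kappa>. (if \<zeta> = \<kappa> then
      \<integral>\<^sup>+u. survival (r \<eta>) (t - u) * (q \<eta> \<kappa> * survival (r \<zeta>) u) \<partial>lborel else 0) \<partial>count_space X)"
    using 0 by (rule nn_integral_count_space_point[symmetric])
  also have "\<dots> = (\<integral>\<^sup>+\<kappa>. \<integral>\<^sup>+u. survival (r \<eta>) (t - u) * (q \<eta> \<kappa> * kernel 0 \<kappa> \<zeta> u) \<partial>lborel \<partial>count_space X)"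
    by (intro nn_integral_cong) auto
  finally show ?case .
next
  case (Suc n)
  let ?S = "\<lambda>\<xi>. survival (r \<xi>)" and ?C = "count_space X"
  have "kernel (Suc (Suc n)) \<eta> \<zeta> t =
      (\<integral>\<^sup>+\<xi>. \<integral>\<^sup>+u. kernel (Suc n) \<eta> \<xi> u * (q \<xi> \<zeta> * ?S \<zeta> (t - u)) \<partial>lborel \<partial>?C)"
    by (rule kernel.simps(2))
  also have "\<dots> = (\<integral>\<^sup>+\<xi>. \<integral>\<^sup>+u. (\<integral>\<^sup>+\<kappa>. \<integral>\<^sup>+v. ?S \<eta> (u - v) * (q \<eta> \<kappa> * kernel n \<kappa> \<xi> v) \<partial>lborel \<partial>?C) *
      (q \<xi> \<zeta> * ?S \<zeta> (t - u)) \<partial>lborel \<partial>?C)"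
    by (intro nn_integral_cong) (simp only: Suc.IH space_count_space)
  also have "\<dots> = (\<integral>\<^sup>+\<xi>. \<integral>\<^sup>+u. \<integral>\<^sup>+\<kappa>. \<integral>\<^sup>+v. ?S \<eta> (u - v) * (q \<eta> \<kappa> * q \<xi> \<zeta> * kernel n \<kappa> \<xi> v) * ?S \<zeta> (t - u)
      \<partial>lborel \<partial>?C \<partial>lborel \<partial>?C)"
  proof (intro nn_integral_cong)
    fix \<xi> u
    have "(\<integral>\<^sup>+\<kappa>. \<integral>\<^sup>+v. ?S \<eta> (u - v) * (q \<eta> \<kappa> * q \<xi> \<zeta> * kernel n \<kappa> \<xi> v) * ?S \<zeta> (t - u) \<partial>lborel \<partial>?C) =
        (\<integral>\<^sup>+\<kappa>. \<integral>\<^sup>+v. (?S \<eta> (u - v) * (q \<eta> \<kappa> * kernel n \<kappa> \<xi> v)) * (q \<xi> \<zeta> * ?S \<zeta> (t - u)) \<partial>lborel \<partial>?C)"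
      by (intro nn_integral_cong) (simp only: mult_ac)
    then show "(\<integral>\<^sup>+\<kappa>. \<integral>\<^sup>+v. ?S \<eta> (u - v) * (q \<eta> \<kappa> * kernel n \<kappa> \<xi> v) \<partial>lborel \<partial>?C) *
        (q \<xi> \<zeta> * ?S \<zeta> (t - u)) =
        (\<integral>\<^sup>+\<kappa>. \<integral>\<^sup>+v. ?S \<eta> (u - v) * (q \<eta> \<kappa> * q \<xi> \<zeta> * kernel n \<kappa> \<xi> v) * ?S \<zeta> (t - u) \<partial>lborel \<partial>?C)"
      by (simp add: nn_integral_multc)
  qed
  also have "\<dots> = (\<integral>\<^sup>+\<xi>. \<integral>\<^sup>+\<kappa>. \<integral>\<^sup>+u. \<integral>\<^sup>+v. ?S \<eta> (u - v) * (q \<eta> \<kappa> * q \<xi> \<zeta> * kernel n \<kappa> \<xi> v) * ?S \<zeta> (t - u)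
      \<partial>lborel \<partial>lborel \<partial>?C \<partial>?C)"
    by (intro nn_integral_cong nn_integral_count_space_nn_integral countable_X) measurable
  also have "\<dots> = (\<integral>\<^sup>+\<xi>. \<integral>\<^sup>+\<kappa>. \<integral>\<^sup>+u. \<integral>\<^sup>+v. ?S \<eta> (t - u) * (q \<eta> \<kappa> * q \<xi> \<zeta> * kernel n \<kappa> \<xi> v) * ?S \<zeta> (u - v)
      \<partial>lborel \<partial>lborel \<partial>?C \<partial>?C)"
    by (intro nn_integral_cong convolution_swap) measurable
  also have "\<dots> = (\<integral>\<^sup>+\<kappa>. \<integral>\<^sup>+\<xi>. \<integral>\<^sup>+u. \<integral>\<^sup>+v. ?S \<eta> (t - u) * (q \<eta> \<kappa> * q \<xi> \<zeta> * kernel n \<kappa> \<xi> v) * ?S \<zeta> (u - v)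
      \<partial>lborel \<partial>lborel \<partial>?C \<partial>?C)"
    by (intro nn_integral_count_space_nn_integral countable_X) measurable
  also have "\<dots> = (\<integral>\<^sup>+\<kappa>. \<integral>\<^sup>+u. \<integral>\<^sup>+\<xi>. \<integral>\<^sup>+v. ?S \<eta> (t - u) * (q \<eta> \<kappa> * q \<xi> \<zeta> * kernel n \<kappa> \<xi> v) * ?S \<zeta> (u - v)
      \<partial>lborel \<partial>?C \<partial>lborel \<partial>?C)"
    by (intro nn_integral_cong nn_integral_count_space_nn_integral[symmetric] countable_X) measurable
  also have "\<dots> = (\<integral>\<^sup>+\<kappa>. \<integral>\<^sup>+u. ?S \<eta> (t - u) * (q \<eta> \<kappa> *
      (\<integral>\<^sup>+\<xi>. \<integral>\<^sup>+v. kernel n \<kappa> \<xi> v * (q \<xi> \<zeta> * ?S \<zeta> (u - v)) \<partial>lborel \<partial>?C)) \<partial>lborel \<partial>?C)"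
  proof (intro nn_integral_cong)
    fix \<kappa> u
    have "(\<integral>\<^sup>+\<xi>. \<integral>\<^sup>+v. ?S \<eta> (t - u) * (q \<eta> \<kappa> * q \<xi> \<zeta> * kernel n \<kappa> \<xi> v) * ?S \<zeta> (u - v) \<partial>lborel \<partial>?C) =
        (\<integral>\<^sup>+\<xi>. \<integral>\<^sup>+v. (?S \<eta> (t - u) * q \<eta> \<kappa>) * (kernel n \<kappa> \<xi> v * (q \<xi> \<zeta> * ?S \<zeta> (u - v))) \<partial>lborel \<partial>?C)"
      by (intro nn_integral_cong) (simp only: mult_ac)
    then show "(\<integral>\<^sup>+\<xi>. \<integral>\<^sup>+v. ?S \<eta> (t - u) * (q \<eta> \<kappa> * q \<xi> \<zeta> * kernel n \<kappa> \<xi> v) * ?S \<zeta> (u - v) \<partial>lborel \<partial>?C) =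
        ?S \<eta> (t - u) * (q \<eta> \<kappa> *
        (\<integral>\<^sup>+\<xi>. \<integral>\<^sup>+v. kernel n \<kappa> \<xi> v * (q \<xi> \<zeta> * ?S \<zeta> (u - v)) \<partial>lborel \<partial>?C))"
      by (simp add: nn_integral_cmult mult.assoc)
  qed
  finally show ?case by simp
qed

text \<open>Detailed balance carries the weight across the last jump of the path from \<open>\<eta>\<close> to \<open>\<zeta>\<close>, which is the
  first jump of the reversed path; the forward recursion on one side therefore meets the backward
  recursion on the other.\<close>

lemma kernel_reversible:
  assumes db: "\<And>\<eta> \<zeta>. \<eta> \<in> X \<Longrightarrow> \<zeta> \<in> X \<Longrightarrow> w \<eta> * q \<eta> \<zeta> = w \<zeta> * q \<zeta> \<eta>"
    and "\<eta> \<in> X" and "\<zeta> \<in> X"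
  shows "w \<eta> * kernel n \<eta> \<zeta> t = w \<zeta> * kernel n \<zeta> \<eta> t"
  using assms(2,3)
proof (induction n arbitrary: \<eta> \<zeta> t)
  case (Suc n)
  have "w \<eta> * kernel (Suc n) \<eta> \<zeta> t =
      (\<integral>\<^sup>+\<xi>. \<integral>\<^sup>+u. w \<eta> * kernel n \<eta> \<xi> u * (q \<xi> \<zeta> * survival (r \<zeta>) (t - u)) \<partial>lborel \<partial>count_space X)"
    by (simp add: nn_integral_cmult mult.assoc)
  also have "\<dots> = (\<integral>\<^sup>+\<xi>. \<integral>\<^sup>+u. w \<zeta> * (survival (r \<zeta>) (t - u) * (q \<zeta> \<xi> * kernel n \<xi> \<eta> u))
      \<partial>lborel \<partial>count_space X)"
  proof (intro nn_integral_cong)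
    fix \<xi> u assume "\<xi> \<in> space (count_space X)"
    then have \<xi>: "\<xi> \<in> X" by simp
    have "w \<eta> * kernel n \<eta> \<xi> u * (q \<xi> \<zeta> * survival (r \<zeta>) (t - u)) =
        (w \<xi> * q \<xi> \<zeta>) * (kernel n \<xi> \<eta> u * survival (r \<zeta>) (t - u))"
      unfolding Suc.IH[OF Suc.prems(1) \<xi>] by (simp add: mult_ac)
    also have "\<dots> = w \<zeta> * (survival (r \<zeta>) (t - u) * (q \<zeta> \<xi> * kernel n \<xi> \<eta> u))"
      unfolding db[OF \<xi> Suc.prems(2)] by (simp add: mult_ac)
    finally show "w \<eta> * kernel n \<eta> \<xi> u * (q \<xi> \<zeta> * survival (r \<zeta>) (t - u)) = \<dots>" .
  qed
  also have "\<dots> = w \<zeta> * (\<integral>\<^sup>+\<xi>. \<integral>\<^sup>+u. survival (r \<zeta>) (t - u) * (q \<zeta> \<xi> * kernel n \<xi> \<eta> u)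
      \<partial>lborel \<partial>count_space X)"
    by (simp add: nn_integral_cmult)
  also have "\<dots> = w \<zeta> * kernel (Suc n) \<zeta> \<eta> t"
    by (simp only: kernel_backward[OF Suc.prems(2,1)])
  finally show ?case .
qed auto

end


section \<open>Exponential holding times\<close>

abbreviation exp_law :: "real measure" where
  "exp_law \<equiv> density lborel (\<lambda>s. ennreal (exponential_density 1 s))"

text \<open>The probability that a clock of rate \<open>r\<close> started at time \<open>T\<close> has been started by time \<open>t\<close> but has
  not yet rung. The starting time may be infinite, as after an absorbing state.\<close>

definition waiting :: "real \<Rightarrow> ennreal \<Rightarrow> real \<Rightarrow> ennreal" where
  "waiting r T t = (if T \<le> ennreal t then survival r (t - enn2real T) else 0)"

lemma waiting_measurable [measurable (raw)]:
  assumes [measurable]: "T \<in> borel_measurable M" "t \<in> borel_measurable M"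
  shows "(\<lambda>x. waiting r (T x) (t x)) \<in> borel_measurable M"
  unfolding waiting_def survival_def by measurable

lemma waiting_infinity: "waiting r \<infinity> t = 0"
  by (simp add: waiting_def top_unique)

lemma waiting_negative:
  assumes "t < 0" shows "waiting r T t = 0"
proof -
  have "\<not> 0 \<le> t - enn2real T" using assms enn2real_nonneg[of T] by linarith
  then show ?thesis by (simp add: waiting_def survival_def)
qed

lemma waiting_ennreal: "0 \<le> u \<Longrightarrow> waiting r (ennreal u) t = survival r (t - u)"
  by (cases "0 \<le> t") (auto simp: waiting_def survival_def ennreal_neg)

lemma prob_space_exp_law: "prob_space exp_law"
  by (rule prob_space_exponential_density) simp

lemma emeasure_exp_law_greater:
  assumes "0 \<le> a" shows "emeasure exp_law {a<..} = ennreal (exp (- a))"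
proof -
  interpret prob_space exp_law by (rule prob_space_exp_law)
  have "distributed exp_law lborel (\<lambda>s. s) (\<lambda>s. ennreal (exponential_density 1 s))"
    unfolding distributed_def by (auto simp: distr_id2 sets_density)
  then have "\<P>(s in exp_law. a < s) = exp (- a * 1)"
    using assms by (rule exponential_distributedD_gt) simp
  then show ?thesis by (simp add: emeasure_eq_measure greaterThan_def)
qed

text \<open>Multiplying out covers the rate \<open>r = 0\<close> as well, where both sides say \<open>0 < s\<close> because a positive
  number divided by \<open>0\<close> is \<open>\<infinity>\<close>.\<close>

lemma less_add_divide_ennreal_iff:
  assumes "0 \<le> r" "0 \<le> a" "a \<le> t"
  shows "ennreal t < ennreal a + ennreal s / ennreal r \<longleftrightarrow> r * (t - a) < s"
proof (cases "r = 0")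
  case True
  then show ?thesis
    using assms by (cases "0 < s") (auto simp: ennreal_neg not_less ennreal_divide_zero ennreal_zero_divide)
next
  case False
  with assms have r: "0 < r" by simp
  show ?thesis
  proof (cases "0 \<le> s")
    case True
    then have "ennreal a + ennreal s / ennreal r = ennreal (a + s / r)"
      using assms r by (simp add: divide_ennreal ennreal_plus)
    then show ?thesis using assms r True by (simp add: ennreal_less_iff field_simps)
  next
    case False
    then have "\<not> r * (t - a) < s" using assms by (smt (verit) mult_nonneg_nonneg)
    then show ?thesis using False assms by (simp add: ennreal_neg not_less ennreal_leI)
  qed
qed

lemma nn_integral_exp_law_straddle:
  assumes "0 \<le> r" "0 \<le> t"
  shows "(\<integral>\<^sup>+s. (if T \<le> ennreal t \<and> ennreal t < T + ennreal s / ennreal r then 1 else 0) \<partial>exp_law)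
    = waiting r T t"
proof (cases "T \<le> ennreal t")
  case True
  then obtain a where a: "T = ennreal a" "0 \<le> a" by (cases T) (auto simp: top_unique)
  with True assms have "a \<le> t" by simp
  then have "(\<integral>\<^sup>+s. (if T \<le> ennreal t \<and> ennreal t < T + ennreal s / ennreal r then 1 else 0) \<partial>exp_law)
      = (\<integral>\<^sup>+s. indicator {r * (t - a)<..} s \<partial>exp_law)"
    using True assms a by (intro nn_integral_cong) (auto simp: less_add_divide_ennreal_iff)
  also have "\<dots> = emeasure exp_law {r * (t - a)<..}"
    by (rule nn_integral_indicator) simp
  also have "\<dots> = ennreal (exp (- (r * (t - a))))"
    using assms \<open>a \<le> t\<close> by (intro emeasure_exp_law_greater) simp
  finally show ?thesis
    using a \<open>a \<le> t\<close> True by (simp add: waiting_def survival_def)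
qed (simp add: waiting_def)

text \<open>The ringing time has density \<open>r\<close> times the probability of still waiting. For \<open>r = 0\<close> it is
  almost surely infinite, where \<open>h\<close> vanishes.\<close>

lemma nn_integral_exp_law_shift:
  assumes [measurable]: "h \<in> borel_measurable borel" and h: "h \<infinity> = 0" and "0 \<le> r"
  shows "(\<integral>\<^sup>+s. h (T + ennreal s / ennreal r) \<partial>exp_law) =
    ennreal r * (\<integral>\<^sup>+u. waiting r T u * h (ennreal u) \<partial>lborel)"
proof -
  have eq: "(\<integral>\<^sup>+s. h (T + ennreal s / ennreal r) \<partial>exp_law) =
      (\<integral>\<^sup>+s. ennreal (exponential_density 1 s) * h (T + ennreal s / ennreal r) \<partial>lborel)"
    by (rule nn_integral_density) measurable
  show ?thesis
  proof (cases "r = 0")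
    case True
    have "AE s in lborel. (s::real) \<noteq> 0" by (rule AE_lborel_singleton)
    then have "AE s in lborel. ennreal (exponential_density 1 s) * h (T + ennreal s / ennreal r) = 0"
    proof eventually_elim
      case (elim s)
      show ?case
      proof (cases "0 < s")
        case True
        then have "ennreal s / ennreal r = \<infinity>"
          using \<open>r = 0\<close> by (simp add: ennreal_divide_zero)
        then show ?thesis using h by simp
      qed (use elim in \<open>simp add: exponential_density_def\<close>)
    qed
    then have "(\<integral>\<^sup>+s. ennreal (exponential_density 1 s) * h (T + ennreal s / ennreal r) \<partial>lborel) = 0"
      by (subst nn_integral_0_iff_AE) auto
    then show ?thesis using True eq by simp
  next
    case False
    with assms have r: "0 < r" by simp
    show ?thesis
    proof (cases T)
      case top
      then show ?thesis using h by (simp add: waiting_infinity[unfolded infinity_ennreal_def])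
    next
      case (real a)
      have "(\<integral>\<^sup>+s. ennreal (exponential_density 1 s) * h (T + ennreal s / ennreal r) \<partial>lborel) =
          ennreal r * (\<integral>\<^sup>+u. ennreal (exponential_density 1 (- r * a + r * u)) *
            h (T + ennreal (- r * a + r * u) / ennreal r) \<partial>lborel)"
        using r by (subst nn_integral_real_affine[where c = r and t = "- r * a"]) auto
      also have "\<dots> = ennreal r * (\<integral>\<^sup>+u. waiting r T u * h (ennreal u) \<partial>lborel)"
      proof (intro arg_cong[where f = "\<lambda>z. ennreal r * z"] nn_integral_cong)
        fix u :: real
        have lin: "- r * a + r * u = r * (u - a)" by (simp add: algebra_simps)
        show "ennreal (exponential_density 1 (- r * a + r * u)) *
            h (T + ennreal (- r * a + r * u) / ennreal r) = waiting r T u * h (ennreal u)"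
        proof (cases "a \<le> u")
          case True
          then have "ennreal (r * (u - a)) / ennreal r = ennreal (u - a)"
            using r by (simp add: divide_ennreal)
          then have "T + ennreal (r * (u - a)) / ennreal r = ennreal u"
            using real True by (simp add: ennreal_plus[symmetric] del: ennreal_plus)
          moreover have "0 \<le> r * (u - a)" using True r by simp
          ultimately show ?thesis
            unfolding lin using real True
            by (simp add: waiting_ennreal survival_def exponential_density_def not_less)
        next
          case False
          then have "r * (u - a) < 0" using r by (simp add: mult_pos_neg)
          then show ?thesis
            unfolding lin using real False
            by (simp add: waiting_ennreal survival_def exponential_density_def)
        qed
      qed
      finally show ?thesis using eq by simp
    qed
  qed
qed



section \<open>The minimal jump chain\<close>

abbreviation instruction_law ::
  "(int \<Rightarrow> int \<Rightarrow> config \<Rightarrow> real) \<Rightarrow> config \<Rightarrow> ((int \<times> int) \<times> real) measure" where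
  "instruction_law p \<zeta> \<equiv> measure_pmf (jump_pmf p \<zeta>) \<Otimes>\<^sub>M exp_law"

lemma prob_space_instruction_law: "prob_space (instruction_law p \<zeta>)"
  by (intro prob_space_pair prob_space_exp_law prob_space_measure_pmf)

lemma prob_space_instruction_measure: "prob_space (instruction_measure p)"
  unfolding instruction_measure_def
  by (intro prob_space_PiM) (auto intro: prob_space_instruction_law)

lemma instruction_component [measurable]:
  "(\<lambda>\<omega>. \<omega> (n, \<zeta>)) \<in> measurable (instruction_measure p) (instruction_law p \<zeta>)"
  using measurable_component_singleton[of "(n, \<zeta>)" UNIV "\<lambda>(n, \<zeta>). instruction_law p \<zeta>"]
  by (simp add: instruction_measure_def)

lemma instruction_clock [measurable]:
  "(\<lambda>\<omega>. snd (\<omega> (n, \<zeta>))) \<in> borel_measurable (instruction_measure p)"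
proof -
  have "(\<lambda>\<omega>. snd (\<omega> (n, \<zeta>))) \<in> measurable (instruction_measure p) exp_law"
    by (rule measurable_compose[OF instruction_component measurable_snd])
  then show ?thesis by simp
qed

lemma space_instruction_measure: "space (instruction_measure p) = UNIV"
  by (auto simp: instruction_measure_def space_PiM space_pair_measure split: prod.splits)

text \<open>Overwriting one coordinate of a product measure by an independent copy does not change the law.
  This expresses the independence of an instruction from all others without splitting the
  uncountable index set, and it yields the Markov property below: the first \<open>n\<close> jumps do not look
  at the instructions with index \<open>n\<close>.\<close>

lemma nn_integral_resample:
  assumes F: "F \<in> borel_measurable (instruction_measure p)"
  shows "(\<integral>\<^sup>+\<omega>. F \<omega> \<partial>instruction_measure p) =
    (\<integral>\<^sup>+\<omega>. \<integral>\<^sup>+v. F (\<omega> ((n, \<zeta>) := v)) \<partial>instruction_law p \<zeta> \<partial>instruction_measure p)"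
proof -
  let ?M = "\<lambda>(n :: nat, \<zeta>). instruction_law p \<zeta>" and ?P = "instruction_measure p"
  interpret I: prob_space ?P by (rule prob_space_instruction_measure)
  interpret L: prob_space "instruction_law p \<zeta>" by (rule prob_space_instruction_law)
  interpret pair_prob_space "instruction_law p \<zeta>" ?P ..
  have eq: "distr (instruction_law p \<zeta> \<Otimes>\<^sub>M ?P) ?P (\<lambda>(v, \<omega>). \<omega> ((n, \<zeta>) := v)) = ?P"
    using distr_pair_PiM_eq_PiM[of UNIV ?M "(n, \<zeta>)"] prob_space_instruction_law
    by (auto simp: instruction_measure_def)
  have upd: "(\<lambda>(v, \<omega>). \<omega> ((n, \<zeta>) := v)) \<in> measurable (instruction_law p \<zeta> \<Otimes>\<^sub>M ?P) ?P"
    unfolding instruction_measure_def case_prod_unfold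
    by (rule measurable_fun_upd[where J = UNIV]) (auto simp del: fun_upd_apply)
  have "(\<integral>\<^sup>+\<omega>. F \<omega> \<partial>?P) =
      (\<integral>\<^sup>+\<omega>. F \<omega> \<partial>distr (instruction_law p \<zeta> \<Otimes>\<^sub>M ?P) ?P (\<lambda>(v, \<omega>). \<omega> ((n, \<zeta>) := v)))"
    by (simp only: eq)
  also have "\<dots> = (\<integral>\<^sup>+z. F ((\<lambda>(v, \<omega>). \<omega> ((n, \<zeta>) := v)) z) \<partial>(instruction_law p \<zeta> \<Otimes>\<^sub>M ?P))"
    by (rule nn_integral_distr[OF upd]) (simp add: F)
  also have "\<dots> = (\<integral>\<^sup>+z. (case z of (v, \<omega>) \<Rightarrow> F (\<omega> ((n, \<zeta>) := v))) \<partial>(instruction_law p \<zeta> \<Otimes>\<^sub>M ?P))"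
    by (simp add: case_prod_unfold)
  also have "\<dots> = (\<integral>\<^sup>+\<omega>. \<integral>\<^sup>+v. F (\<omega> ((n, \<zeta>) := v)) \<partial>instruction_law p \<zeta> \<partial>?P)"
    using measurable_compose[OF upd F]
    by (subst nn_integral_snd[symmetric]) (auto simp: case_prod_unfold)
  finally show ?thesis .
qed

lemma jump_chain_update:
  "m \<le> n \<Longrightarrow> jump_chain (\<omega> ((n, \<zeta>) := v)) \<eta> m = jump_chain \<omega> \<eta> m"
  by (induction m) auto

lemma jump_time_update:
  "m \<le> n \<Longrightarrow> jump_time p (\<omega> ((n, \<zeta>) := v)) \<eta> m = jump_time p \<omega> \<eta> m"
  unfolding jump_time_def holding_time_def
  by (intro sum.cong refl) (simp add: jump_chain_update)

lemma jump_chain_in_blocking: "\<eta> \<in> blocking_configs \<Longrightarrow> jump_chain \<omega> \<eta> n \<in> blocking_configs"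
  by (induction n) (auto simp: exchange_in_blocking split: prod.split)

lemma jump_time_Suc: "jump_time p \<omega> \<eta> (Suc n) = jump_time p \<omega> \<eta> n + holding_time p \<omega> \<eta> n"
  by (simp add: jump_time_def)

lemma jump_time_mono: "m \<le> n \<Longrightarrow> jump_time p \<omega> \<eta> m \<le> jump_time p \<omega> \<eta> n"
  by (rule lift_Suc_mono_le[of "jump_time p \<omega> \<eta>"]) (auto simp: jump_time_Suc)

text \<open>The instructions are indexed by all configurations, but a chain started from a blocking
  configuration consults only countably many of them.\<close>

lemma jump_chain_measurable [measurable]:
  assumes "\<eta> \<in> blocking_configs"
  shows "(\<lambda>\<omega>. jump_chain \<omega> \<eta> n) \<in> measurable (instruction_measure p) (count_space blocking_configs)"
proof (induction n)
  case 0
  then show ?case using assms by simp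
next
  case (Suc n)
  have "(\<lambda>\<omega>. case fst (\<omega> (n, \<xi>)) of (x, y) \<Rightarrow> exchange x y \<xi>)
      \<in> measurable (instruction_measure p) (count_space blocking_configs)"
    if "\<xi> \<in> blocking_configs" for \<xi>
  proof -
    have [measurable]: "(\<lambda>(x, y). exchange x y \<xi>) \<in>
        measurable (measure_pmf (jump_pmf p \<xi>)) (count_space blocking_configs)"
      using exchange_in_blocking[OF that] by auto
    show ?thesis by measurable
  qed
  then show ?case
    unfolding jump_chain.simps
    by (rule measurable_compose_countable'[OF _ Suc countable_blocking_configs])
qed

lemma holding_time_measurable [measurable]:
  assumes "\<eta> \<in> blocking_configs"
  shows "(\<lambda>\<omega>. holding_time p \<omega> \<eta> n) \<in> borel_measurable (instruction_measure p)"
  unfolding holding_time_def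
  by (rule measurable_compose_countable'[OF _ jump_chain_measurable[OF assms] countable_blocking_configs])
     measurable

lemma jump_time_measurable [measurable]:
  assumes "\<eta> \<in> blocking_configs"
  shows "(\<lambda>\<omega>. jump_time p \<omega> \<eta> n) \<in> borel_measurable (instruction_measure p)"
  unfolding jump_time_def using assms by measurable

lemma chain_at_eq_Some_iff:
  assumes "0 \<le> t"
  shows "chain_at p \<omega> \<eta> t = Some \<zeta> \<longleftrightarrow>
    (\<exists>n. jump_chain \<omega> \<eta> n = \<zeta> \<and> jump_time p \<omega> \<eta> n \<le> ennreal t \<and> ennreal t < jump_time p \<omega> \<eta> (Suc n))"
proof -
  define Q where "Q n \<longleftrightarrow> ennreal t < jump_time p \<omega> \<eta> (Suc n)" for n
  have zero: "jump_time p \<omega> \<eta> 0 = 0" by (simp add: jump_time_def)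
  have least: "n = (LEAST n. Q n)" if "jump_time p \<omega> \<eta> n \<le> ennreal t" "Q n" for n
  proof (rule Least_equality[symmetric])
    fix m assume "Q m"
    then have "jump_time p \<omega> \<eta> n < jump_time p \<omega> \<eta> (Suc m)"
      using that(1) by (auto simp: Q_def)
    then show "n \<le> m"
      using jump_time_mono[of "Suc m" n p \<omega> \<eta>] by (metis leD not_less_eq_eq)
  qed (rule that)
  have ex: "(\<exists>n. ennreal t < jump_time p \<omega> \<eta> n) \<longleftrightarrow> (\<exists>n. Q n)"
  proof
    assume "\<exists>n. ennreal t < jump_time p \<omega> \<eta> n"
    then obtain n where n: "ennreal t < jump_time p \<omega> \<eta> n" by blast
    with zero have "n \<noteq> 0" by (metis not_less_zero)
    with n show "\<exists>n. Q n" unfolding Q_def by (metis not0_implies_Suc)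
  qed (auto simp: Q_def)
  have le: "jump_time p \<omega> \<eta> (LEAST n. Q n) \<le> ennreal t" if "\<exists>n. Q n"
  proof (cases "LEAST n. Q n")
    case (Suc k)
    then have "\<not> Q k" using not_less_Least[of k Q] by simp
    then show ?thesis using Suc by (simp add: Q_def)
  qed (simp add: zero)
  show ?thesis
    unfolding chain_at_def ex Q_def[symmetric]
    using le least LeastI_ex[of Q] by (auto split: if_splits)
qed

locale exclusion_chain =
  fixes p :: "int \<Rightarrow> int \<Rightarrow> config \<Rightarrow> real"
  assumes p_nonneg: "\<And>x y \<eta>. 0 \<le> p x y \<eta>"
    and p_summable: "\<And>\<zeta>. \<zeta> \<in> blocking_configs \<Longrightarrow> (\<lambda>(x, y). p x y \<zeta>) summable_on UNIV"
begin

definition jump_rate :: "config \<Rightarrow> config \<Rightarrow> ennreal" where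
  "jump_rate \<xi> \<zeta> = (\<integral>\<^sup>+(x, y). (if exchange x y \<xi> = \<zeta> then ennreal (p x y \<xi>) else 0) \<partial>count_space UNIV)"

sublocale jump_kernel blocking_configs jump_rate "total_rate p"
  by unfold_locales (rule countable_blocking_configs)

lemma total_rate_nonneg: "0 \<le> total_rate p \<xi>"
  unfolding total_rate_def by (rule infsum_nonneg) (auto simp: p_nonneg)

lemma nn_integral_rates:
  assumes "\<xi> \<in> blocking_configs"
  shows "(\<integral>\<^sup>+(x, y). ennreal (p x y \<xi>) \<partial>count_space UNIV) = ennreal (total_rate p \<xi>)"
  using nn_integral_count_space_eq_infsum[OF p_summable[OF assms]] p_nonneg
  by (auto simp: total_rate_def case_prod_unfold)

text \<open>At an absorbing state the trivial exchange chosen by \<open>jump_pmf\<close> is harmless, since both sides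
  vanish.\<close>

lemma nn_integral_jump_pmf:
  assumes "\<xi> \<in> blocking_configs"
  shows "ennreal (total_rate p \<xi>) *
      (\<integral>\<^sup>+(x, y). (if exchange x y \<xi> = \<zeta> then 1 else 0) \<partial>measure_pmf (jump_pmf p \<xi>)) = jump_rate \<xi> \<zeta>"
proof (cases "total_rate p \<xi> = 0")
  case True
  have "jump_rate \<xi> \<zeta> \<le> (\<integral>\<^sup>+(x, y). ennreal (p x y \<xi>) \<partial>count_space UNIV)"
    unfolding jump_rate_def by (intro nn_integral_mono) auto
  also have "\<dots> = 0" using nn_integral_rates[OF assms] True by simp
  finally show ?thesis using True by simp
next
  case False
  define r where "r = total_rate p \<xi>"
  have r: "0 < r" using False total_rate_nonneg[of \<xi>] by (simp add: r_def)
  have pmf: "pmf (jump_pmf p \<xi>) j = (case j of (x, y) \<Rightarrow> p x y \<xi> / r)" for j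
  proof -
    have "(\<integral>\<^sup>+j. ennreal (case j of (x, y) \<Rightarrow> p x y \<xi> / r) \<partial>count_space UNIV) =
        (\<integral>\<^sup>+j. (case j of (x, y) \<Rightarrow> ennreal (p x y \<xi>)) / ennreal r \<partial>count_space UNIV)"
      using r p_nonneg by (intro nn_integral_cong) (auto simp: divide_ennreal)
    also have "\<dots> = 1"
      using r by (simp add: nn_integral_divide nn_integral_rates[OF assms] r_def)
    finally show ?thesis
      unfolding jump_pmf_def using False r p_nonneg
      by (auto simp: r_def[symmetric] intro!: pmf_embed_pmf)
  qed
  have "(\<integral>\<^sup>+j. (case j of (x, y) \<Rightarrow> if exchange x y \<xi> = \<zeta> then 1 else 0) \<partial>measure_pmf (jump_pmf p \<xi>)) =
      (\<integral>\<^sup>+j. ennreal (pmf (jump_pmf p \<xi>) j) * (case j of (x, y) \<Rightarrow> if exchange x y \<xi> = \<zeta> then 1 else 0) \<partial>count_space UNIV)"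
    by (rule nn_integral_measure_pmf)
  then have "ennreal r * (\<integral>\<^sup>+j. (case j of (x, y) \<Rightarrow> if exchange x y \<xi> = \<zeta> then 1 else 0) \<partial>measure_pmf (jump_pmf p \<xi>)) =
      (\<integral>\<^sup>+j. ennreal r * (ennreal (pmf (jump_pmf p \<xi>) j) * (case j of (x, y) \<Rightarrow> if exchange x y \<xi> = \<zeta> then 1 else 0)) \<partial>count_space UNIV)"
    by (simp add: nn_integral_cmult)
  also have "\<dots> = jump_rate \<xi> \<zeta>"
    unfolding jump_rate_def pmf
    using r p_nonneg by (intro nn_integral_cong) (auto simp: ennreal_mult[symmetric])
  finally show ?thesis by (simp add: r_def)
qed

end

context exclusion_chain
begin

section \<open>Transition probabilities of the jump chain\<close>

text \<open>The probability of being at \<open>\<zeta>\<close> at time \<open>t\<close> after exactly \<open>n\<close> jumps, with the current holding time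
  already integrated out.\<close>

definition occupation :: "config \<Rightarrow> nat \<Rightarrow> config \<Rightarrow> real \<Rightarrow> ennreal" where
  "occupation \<eta> n \<zeta> t =
     (\<integral>\<^sup>+\<omega>. (if jump_chain \<omega> \<eta> n = \<zeta> then waiting (total_rate p \<zeta>) (jump_time p \<omega> \<eta> n) t else 0)
       \<partial>instruction_measure p)"

context
  fixes \<eta> :: config
  assumes \<eta>: "\<eta> \<in> blocking_configs"
begin

lemma chain_pred_measurable [measurable]:
  "Measurable.pred (instruction_measure p) (\<lambda>\<omega>. jump_chain \<omega> \<eta> n = \<zeta>)"
proof -
  have "(\<lambda>\<xi>. \<xi> = \<zeta>) \<in> measurable (count_space blocking_configs) (count_space UNIV)" by simp
  then show ?thesis by (rule measurable_compose[OF jump_chain_measurable[OF \<eta>]])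
qed

lemmas [measurable] = jump_time_measurable[OF \<eta>] holding_time_measurable[OF \<eta>]

lemma holding_time_fresh:
  "holding_time p (\<omega> ((n, \<zeta>) := v)) \<eta> n =
     (if jump_chain \<omega> \<eta> n = \<zeta> then ennreal (snd v) / ennreal (total_rate p \<zeta>)
      else holding_time p \<omega> \<eta> n)"
  by (simp add: holding_time_def jump_chain_update)

lemma nn_integral_instruction_law_snd:
  assumes "h \<in> borel_measurable borel"
  shows "(\<integral>\<^sup>+v. h (snd v) \<partial>instruction_law p \<zeta>) = (\<integral>\<^sup>+s. h s \<partial>exp_law)"
proof -
  interpret E: prob_space exp_law by (rule prob_space_exp_law)
  have "(\<integral>\<^sup>+v. h (snd v) \<partial>instruction_law p \<zeta>) =
      (\<integral>\<^sup>+j. \<integral>\<^sup>+s. h (snd (j, s)) \<partial>exp_law \<partial>measure_pmf (jump_pmf p \<zeta>))"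
    by (rule E.nn_integral_fst[symmetric]) (use assms in measurable)
  then show ?thesis by (simp add: measure_pmf.emeasure_space_1)
qed

text \<open>Given the first \<open>n\<close> jumps, the holding time in progress is a fresh exponential variable.\<close>

lemma emeasure_occupation:
  assumes "0 \<le> t"
  shows "emeasure (instruction_measure p) {\<omega>. jump_chain \<omega> \<eta> n = \<zeta> \<and>
      jump_time p \<omega> \<eta> n \<le> ennreal t \<and> ennreal t < jump_time p \<omega> \<eta> (Suc n)} = occupation \<eta> n \<zeta> t"
    (is "emeasure ?P ?A = _")
proof -
  let ?T = "\<lambda>\<omega>. jump_time p \<omega> \<eta> n" and ?r = "total_rate p \<zeta>"
  define F where "F \<omega> = (if jump_chain \<omega> \<eta> n = \<zeta> then
      (if ?T \<omega> \<le> ennreal t \<and> ennreal t < ?T \<omega> + holding_time p \<omega> \<eta> n then 1 else 0 :: ennreal) else 0)" for \<omega>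
  have F: "F \<in> borel_measurable ?P" unfolding F_def by measurable
  have A: "?A \<in> sets ?P"
  proof -
    have "{\<omega> \<in> space ?P. jump_chain \<omega> \<eta> n = \<zeta> \<and> ?T \<omega> \<le> ennreal t \<and>
        ennreal t < jump_time p \<omega> \<eta> (Suc n)} \<in> sets ?P" by measurable
    then show ?thesis by (simp add: space_instruction_measure)
  qed
  have "emeasure ?P ?A = (\<integral>\<^sup>+\<omega>. F \<omega> \<partial>?P)"
    unfolding nn_integral_indicator[OF A, symmetric]
    by (intro nn_integral_cong) (auto simp: F_def jump_time_Suc split: split_indicator)
  also have "\<dots> = (\<integral>\<^sup>+\<omega>. \<integral>\<^sup>+v. F (\<omega> ((n, \<zeta>) := v)) \<partial>instruction_law p \<zeta> \<partial>?P)"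
    by (rule nn_integral_resample[OF F])
  also have "\<dots> = (\<integral>\<^sup>+\<omega>. (if jump_chain \<omega> \<eta> n = \<zeta> then waiting ?r (?T \<omega>) t else 0) \<partial>?P)"
  proof (intro nn_integral_cong)
    fix \<omega>
    have "(\<integral>\<^sup>+v. F (\<omega> ((n, \<zeta>) := v)) \<partial>instruction_law p \<zeta>) = (\<integral>\<^sup>+v. (if jump_chain \<omega> \<eta> n = \<zeta> then
        (if ?T \<omega> \<le> ennreal t \<and> ennreal t < ?T \<omega> + ennreal (snd v) / ennreal ?r then 1 else 0) else 0)
        \<partial>instruction_law p \<zeta>)"
      unfolding F_def holding_time_fresh
      by (simp add: jump_chain_update jump_time_update cong: if_cong)
    also have "\<dots> = (if jump_chain \<omega> \<eta> n = \<zeta> then waiting ?r (?T \<omega>) t else 0)"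
    proof (cases "jump_chain \<omega> \<eta> n = \<zeta>")
      case True
      have "(\<integral>\<^sup>+v. (if ?T \<omega> \<le> ennreal t \<and> ennreal t < ?T \<omega> + ennreal (snd v) / ennreal ?r then 1 else 0)
          \<partial>instruction_law p \<zeta>) = waiting ?r (?T \<omega>) t"
        unfolding nn_integral_exp_law_straddle[OF total_rate_nonneg assms, symmetric]
        by (rule nn_integral_instruction_law_snd) measurable
      with True show ?thesis by simp
    qed simp
    finally show "(\<integral>\<^sup>+v. F (\<omega> ((n, \<zeta>) := v)) \<partial>instruction_law p \<zeta>) = \<dots>" .
  qed
  finally show ?thesis by (simp add: occupation_def)
qed

text \<open>Jumps into \<open>\<zeta>\<close> occur at time \<open>u\<close> with intensity \<open>\<Sum>\<^sub>\<xi> k\<^sub>n(\<eta>, \<xi>, u) q(\<xi>, \<zeta>)\<close>, where \<open>k\<^sub>n\<close> is the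
  occupation probability: the fresh instruction at \<open>(n, \<xi>)\<close> supplies the exchange and the holding
  time independently. The condition on \<open>h\<close> discards jumps that never happen.\<close>

lemma jump_intensity:
  assumes [measurable]: "h \<in> borel_measurable borel" and h: "h \<infinity> = 0"
  shows "(\<integral>\<^sup>+\<omega>. (if jump_chain \<omega> \<eta> (Suc n) = \<zeta> then h (jump_time p \<omega> \<eta> (Suc n)) else 0) \<partial>instruction_measure p)
    = (\<integral>\<^sup>+\<xi>. \<integral>\<^sup>+u. occupation \<eta> n \<xi> u * (jump_rate \<xi> \<zeta> * h (ennreal u)) \<partial>lborel \<partial>count_space blocking_configs)"
proof -
  let ?P = "instruction_measure p" and ?T = "\<lambda>\<omega>. jump_time p \<omega> \<eta> n"
  interpret P: prob_space ?P by (rule prob_space_instruction_measure)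
  interpret E: prob_space exp_law by (rule prob_space_exp_law)
  define hit :: "config \<Rightarrow> int \<times> int \<Rightarrow> ennreal"
    where "hit \<xi> j = (case j of (x, y) \<Rightarrow> if exchange x y \<xi> = \<zeta> then 1 else 0)" for \<xi> j
  define G where "G \<xi> \<omega> = (if jump_chain \<omega> \<eta> n = \<xi> then hit \<xi> (fst (\<omega> (n, \<xi>))) *
      h (?T \<omega> + ennreal (snd (\<omega> (n, \<xi>))) / ennreal (total_rate p \<xi>)) else 0)" for \<xi> \<omega>
  have hit_meas: "(\<lambda>\<omega>. hit \<xi> (fst (\<omega> (n, \<xi>)))) \<in> borel_measurable ?P" for \<xi>
  proof -
    have "hit \<xi> \<in> borel_measurable (measure_pmf (jump_pmf p \<xi>))" by simp
    then show ?thesis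
      by (rule measurable_compose[OF measurable_compose[OF instruction_component measurable_fst]])
  qed
  note [measurable] = hit_meas
  have G: "G \<xi> \<in> borel_measurable ?P" for \<xi>
    unfolding G_def by measurable
  have "(\<integral>\<^sup>+\<omega>. (if jump_chain \<omega> \<eta> (Suc n) = \<zeta> then h (jump_time p \<omega> \<eta> (Suc n)) else 0) \<partial>?P) =
      (\<integral>\<^sup>+\<omega>. \<integral>\<^sup>+\<xi>. G \<xi> \<omega> \<partial>count_space blocking_configs \<partial>?P)"
  proof (intro nn_integral_cong)
    fix \<omega>
    show "(if jump_chain \<omega> \<eta> (Suc n) = \<zeta> then h (jump_time p \<omega> \<eta> (Suc n)) else 0) =
        (\<integral>\<^sup>+\<xi>. G \<xi> \<omega> \<partial>count_space blocking_configs)"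
      unfolding G_def
      by (subst nn_integral_count_space_point[OF jump_chain_in_blocking[OF \<eta>]])
         (auto simp: hit_def jump_time_Suc holding_time_def split: prod.splits)
  qed
  also have "\<dots> = (\<integral>\<^sup>+\<xi>. \<integral>\<^sup>+\<omega>. G \<xi> \<omega> \<partial>?P \<partial>count_space blocking_configs)"
    by (rule nn_integral_count_space_nn_integral[OF countable_blocking_configs G])
  also have "\<dots> = (\<integral>\<^sup>+\<xi>. \<integral>\<^sup>+u. occupation \<eta> n \<xi> u * (jump_rate \<xi> \<zeta> * h (ennreal u)) \<partial>lborel
      \<partial>count_space blocking_configs)"
  proof (rule nn_integral_cong)
    fix \<xi> assume "\<xi> \<in> space (count_space blocking_configs)"
    then have \<xi>: "\<xi> \<in> blocking_configs" by simp
    let ?r = "total_rate p \<xi>"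
    have fresh: "(\<integral>\<^sup>+v. hit \<xi> (fst v) * h (T + ennreal (snd v) / ennreal ?r) \<partial>instruction_law p \<xi>) =
        jump_rate \<xi> \<zeta> * (\<integral>\<^sup>+u. waiting ?r T u * h (ennreal u) \<partial>lborel)" for T
    proof -
      have [measurable]: "hit \<xi> \<in> borel_measurable (measure_pmf (jump_pmf p \<xi>))" by simp
      have "(\<integral>\<^sup>+v. hit \<xi> (fst v) * h (T + ennreal (snd v) / ennreal ?r) \<partial>instruction_law p \<xi>) =
          (\<integral>\<^sup>+j. \<integral>\<^sup>+s. hit \<xi> (fst (j, s)) * h (T + ennreal (snd (j, s)) / ennreal ?r) \<partial>exp_law
            \<partial>measure_pmf (jump_pmf p \<xi>))"
        by (rule E.nn_integral_fst[symmetric]) measurable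
      also have "\<dots> = (\<integral>\<^sup>+j. hit \<xi> j * (\<integral>\<^sup>+s. h (T + ennreal s / ennreal ?r) \<partial>exp_law)
            \<partial>measure_pmf (jump_pmf p \<xi>))"
        by (intro nn_integral_cong) (simp add: nn_integral_cmult)
      also have "\<dots> = (\<integral>\<^sup>+j. hit \<xi> j \<partial>measure_pmf (jump_pmf p \<xi>)) *
          (\<integral>\<^sup>+s. h (T + ennreal s / ennreal ?r) \<partial>exp_law)"
        by (rule nn_integral_multc) simp
      also have "\<dots> = ennreal ?r * (\<integral>\<^sup>+j. hit \<xi> j \<partial>measure_pmf (jump_pmf p \<xi>)) *
          (\<integral>\<^sup>+u. waiting ?r T u * h (ennreal u) \<partial>lborel)"
        unfolding nn_integral_exp_law_shift[OF assms total_rate_nonneg] by (simp only: mult_ac)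
      also have "ennreal ?r * (\<integral>\<^sup>+j. hit \<xi> j \<partial>measure_pmf (jump_pmf p \<xi>)) = jump_rate \<xi> \<zeta>"
        unfolding hit_def by (rule nn_integral_jump_pmf[OF \<xi>])
      finally show ?thesis .
    qed
    have "(\<integral>\<^sup>+\<omega>. G \<xi> \<omega> \<partial>?P) = (\<integral>\<^sup>+\<omega>. \<integral>\<^sup>+v. G \<xi> (\<omega> ((n, \<xi>) := v)) \<partial>instruction_law p \<xi> \<partial>?P)"
      by (rule nn_integral_resample[OF G])
    also have "\<dots> = (\<integral>\<^sup>+\<omega>. (if jump_chain \<omega> \<eta> n = \<xi> then
        jump_rate \<xi> \<zeta> * (\<integral>\<^sup>+u. waiting ?r (?T \<omega>) u * h (ennreal u) \<partial>lborel) else 0) \<partial>?P)"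
    proof (rule nn_integral_cong)
      fix \<omega>
      show "(\<integral>\<^sup>+v. G \<xi> (\<omega> ((n, \<xi>) := v)) \<partial>instruction_law p \<xi>) = (if jump_chain \<omega> \<eta> n = \<xi> then
        jump_rate \<xi> \<zeta> * (\<integral>\<^sup>+u. waiting ?r (?T \<omega>) u * h (ennreal u) \<partial>lborel) else 0)"
        by (simp add: G_def jump_chain_update jump_time_update fresh)
    qed
    also have "\<dots> = (\<integral>\<^sup>+\<omega>. \<integral>\<^sup>+u. (if jump_chain \<omega> \<eta> n = \<xi> then waiting ?r (?T \<omega>) u else 0) *
        (jump_rate \<xi> \<zeta> * h (ennreal u)) \<partial>lborel \<partial>?P)"
    proof (rule nn_integral_cong)
      fix \<omega>
      have "(\<integral>\<^sup>+u. waiting ?r (?T \<omega>) u * (jump_rate \<xi> \<zeta> * h (ennreal u)) \<partial>lborel) =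
          (\<integral>\<^sup>+u. jump_rate \<xi> \<zeta> * (waiting ?r (?T \<omega>) u * h (ennreal u)) \<partial>lborel)"
        by (simp only: mult_ac)
      also have "\<dots> = jump_rate \<xi> \<zeta> * (\<integral>\<^sup>+u. waiting ?r (?T \<omega>) u * h (ennreal u) \<partial>lborel)"
        by (rule nn_integral_cmult) measurable
      finally show "(if jump_chain \<omega> \<eta> n = \<xi> then
          jump_rate \<xi> \<zeta> * (\<integral>\<^sup>+u. waiting ?r (?T \<omega>) u * h (ennreal u) \<partial>lborel) else 0) =
          (\<integral>\<^sup>+u. (if jump_chain \<omega> \<eta> n = \<xi> then waiting ?r (?T \<omega>) u else 0) *
            (jump_rate \<xi> \<zeta> * h (ennreal u)) \<partial>lborel)" by simp
    qed
    also have "\<dots> = (\<integral>\<^sup>+u. \<integral>\<^sup>+\<omega>. (if jump_chain \<omega> \<eta> n = \<xi> then waiting ?r (?T \<omega>) u else 0) *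
        (jump_rate \<xi> \<zeta> * h (ennreal u)) \<partial>?P \<partial>lborel)"
    proof -
      interpret pair_sigma_finite lborel ?P ..
      show ?thesis by (rule Fubini') measurable
    qed
    also have "\<dots> = (\<integral>\<^sup>+u. occupation \<eta> n \<xi> u * (jump_rate \<xi> \<zeta> * h (ennreal u)) \<partial>lborel)"
      unfolding occupation_def by (intro nn_integral_cong nn_integral_multc) measurable
    finally show "(\<integral>\<^sup>+\<omega>. G \<xi> \<omega> \<partial>?P) = \<dots>" .
  qed
  finally show ?thesis .
qed

text \<open>The intensity formula applied to \<open>h = \<close> the probability that the holding time at \<open>\<zeta>\<close>, started at the
  jump, is still running at time \<open>t\<close>, is the forward recursion.\<close>

lemma occupation_eq_kernel: "occupation \<eta> n \<zeta> t = kernel n \<eta> \<zeta> t"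
proof (induction n arbitrary: \<zeta> t)
  case 0
  interpret prob_space "instruction_measure p" by (rule prob_space_instruction_measure)
  show ?case
    using waiting_ennreal[of 0] emeasure_space_1 by (simp add: occupation_def jump_time_def)
next
  case (Suc n)
  let ?r = "total_rate p \<zeta>"
  have "occupation \<eta> (Suc n) \<zeta> t = (\<integral>\<^sup>+\<xi>. \<integral>\<^sup>+u. occupation \<eta> n \<xi> u *
      (jump_rate \<xi> \<zeta> * waiting ?r (ennreal u) t) \<partial>lborel \<partial>count_space blocking_configs)"
    unfolding occupation_def[of \<eta> "Suc n"]
    by (rule jump_intensity) (measurable, rule waiting_infinity)
  also have "\<dots> = (\<integral>\<^sup>+\<xi>. \<integral>\<^sup>+u. kernel n \<eta> \<xi> u * (jump_rate \<xi> \<zeta> * survival ?r (t - u))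
      \<partial>lborel \<partial>count_space blocking_configs)"
  proof (intro nn_integral_cong)
    fix \<xi> u
    show "occupation \<eta> n \<xi> u * (jump_rate \<xi> \<zeta> * waiting ?r (ennreal u) t) =
        kernel n \<eta> \<xi> u * (jump_rate \<xi> \<zeta> * survival ?r (t - u))"
    proof (cases "0 \<le> u")
      case False
      then have "occupation \<eta> n \<xi> u = 0"
        by (simp add: occupation_def waiting_negative not_le cong: if_cong)
      then show ?thesis using Suc[of \<xi> u] by simp
    qed (simp add: Suc waiting_ennreal)
  qed
  finally show ?case by simp
qed

end

definition transition :: "real \<Rightarrow> config \<Rightarrow> config \<Rightarrow> ennreal" where
  "transition t \<eta> \<zeta> = emeasure (instruction_measure p) {\<omega>. chain_at p \<omega> \<eta> t = Some \<zeta>}"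

lemma
  assumes \<eta>: "\<eta> \<in> blocking_configs" and t: "0 \<le> t"
  shows chain_at_sets: "{\<omega>. chain_at p \<omega> \<eta> t = Some \<zeta>} \<in> sets (instruction_measure p)"
    and transition_eq_kernel: "transition t \<eta> \<zeta> = (\<Sum>n. kernel n \<eta> \<zeta> t)"
proof -
  let ?P = "instruction_measure p"
  define A where "A n = {\<omega>. jump_chain \<omega> \<eta> n = \<zeta> \<and> jump_time p \<omega> \<eta> n \<le> ennreal t \<and>
    ennreal t < jump_time p \<omega> \<eta> (Suc n)}" for n
  note [measurable] = chain_pred_measurable[OF \<eta>] jump_time_measurable[OF \<eta>]
  have A: "A n \<in> sets ?P" for n
  proof -
    have "{\<omega> \<in> space ?P. jump_chain \<omega> \<eta> n = \<zeta> \<and> jump_time p \<omega> \<eta> n \<le> ennreal t \<and>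
        ennreal t < jump_time p \<omega> \<eta> (Suc n)} \<in> sets ?P" by measurable
    then show ?thesis by (simp add: A_def space_instruction_measure)
  qed
  have eq: "{\<omega>. chain_at p \<omega> \<eta> t = Some \<zeta>} = (\<Union>n. A n)"
    by (auto simp: chain_at_eq_Some_iff[OF t] A_def)
  then show "{\<omega>. chain_at p \<omega> \<eta> t = Some \<zeta>} \<in> sets ?P" using A by auto
  have "disjoint_family A"
  proof -
    have "A m \<inter> A n = {}" if "m < n" for m n
      using jump_time_mono[of "Suc m" n] that
      by (auto simp: A_def simp flip: not_less) (meson leD le_less_trans less_le_trans not_less Suc_leI)
    then show ?thesis unfolding disjoint_family_on_def by (metis Int_commute nat_neq_iff)
  qed
  then have "transition t \<eta> \<zeta> = (\<Sum>n. emeasure ?P (A n))"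
    unfolding transition_def eq using A by (subst suminf_emeasure) auto
  also have "\<dots> = (\<Sum>n. kernel n \<eta> \<zeta> t)"
    unfolding A_def emeasure_occupation[OF \<eta> t] occupation_eq_kernel[OF \<eta>] ..
  finally show "transition t \<eta> \<zeta> = (\<Sum>n. kernel n \<eta> \<zeta> t)" .
qed

end

context exclusion_chain
begin

lemma transition_reversible:
  assumes "\<And>\<eta> \<zeta>. \<eta> \<in> blocking_configs \<Longrightarrow> \<zeta> \<in> blocking_configs \<Longrightarrow>
      w \<eta> * jump_rate \<eta> \<zeta> = w \<zeta> * jump_rate \<zeta> \<eta>"
    and "\<eta> \<in> blocking_configs" "\<zeta> \<in> blocking_configs" and t: "0 \<le> t"
  shows "w \<eta> * transition t \<eta> \<zeta> = w \<zeta> * transition t \<zeta> \<eta>"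
  using assms(2,3)
  by (simp add: transition_eq_kernel[OF _ t] ennreal_suminf_cmult[symmetric]
      kernel_reversible[OF assms(1)] del: ennreal_suminf_cmult)

lemma nn_integral_transition_le:
  assumes \<eta>: "\<eta> \<in> blocking_configs" and t: "0 \<le> t"
  shows "(\<integral>\<^sup>+\<zeta>. transition t \<eta> \<zeta> \<partial>count_space blocking_configs) \<le> 1"
proof -
  let ?P = "instruction_measure p" and ?C = "count_space blocking_configs"
  interpret prob_space ?P by (rule prob_space_instruction_measure)
  let ?S = "\<lambda>\<zeta>. {\<omega>. chain_at p \<omega> \<eta> t = Some \<zeta>}"
  have "(\<integral>\<^sup>+\<zeta>. transition t \<eta> \<zeta> \<partial>?C) = (\<integral>\<^sup>+\<zeta>. \<integral>\<^sup>+\<omega>. indicator (?S \<zeta>) \<omega> \<partial>?P \<partial>?C)"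
    unfolding transition_def using chain_at_sets[OF assms] by simp
  also have "\<dots> = (\<integral>\<^sup>+\<omega>. \<integral>\<^sup>+\<zeta>. indicator (?S \<zeta>) \<omega> \<partial>?C \<partial>?P)"
    using chain_at_sets[OF assms]
    by (intro nn_integral_count_space_nn_integral[symmetric] countable_blocking_configs) simp
  also have "\<dots> \<le> (\<integral>\<^sup>+\<omega>. 1 \<partial>?P)"
  proof (rule nn_integral_mono)
    fix \<omega>
    have "(\<integral>\<^sup>+\<zeta>. indicator (?S \<zeta>) \<omega> \<partial>?C) \<le> (\<integral>\<^sup>+\<zeta>. indicator {the (chain_at p \<omega> \<eta> t)} \<zeta> \<partial>count_space UNIV)"
      by (subst nn_integral_count_space_indicator, simp)
         (intro nn_integral_mono, auto split: split_indicator)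
    also have "\<dots> = 1" by simp
    finally show "(\<integral>\<^sup>+\<zeta>. indicator (?S \<zeta>) \<omega> \<partial>?C) \<le> 1" .
  qed
  also have "\<dots> = 1" using emeasure_space_1 by simp
  finally show ?thesis .
qed

lemma transition_le_1: "transition t \<eta> \<zeta> \<le> 1"
proof -
  interpret prob_space "instruction_measure p" by (rule prob_space_instruction_measure)
  show ?thesis unfolding transition_def by (rule emeasure_le_1)
qed

text \<open>Writing the value of \<open>g\<close> at the current state as an integral over all blocking states makes the
  formula an instance of Fubini's theorem; after an explosion every term vanishes.\<close>

lemma semigroup_eq:
  fixes g :: "config \<Rightarrow> real"
  assumes \<eta>: "\<eta> \<in> blocking_configs" and t: "0 \<le> t" and g: "bounded (g ` blocking_configs)"
  shows "semigroup p t g \<eta> =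
    (\<integral>\<zeta>. g \<zeta> * enn2real (transition t \<eta> \<zeta>) \<partial>count_space blocking_configs)"
proof -
  let ?P = "instruction_measure p" and ?C = "count_space blocking_configs"
  let ?S = "\<lambda>\<zeta>. {\<omega>. chain_at p \<omega> \<eta> t = Some \<zeta>}"
  interpret P: prob_space ?P by (rule prob_space_instruction_measure)
  interpret C: sigma_finite_measure ?C
    by (rule sigma_finite_measure_count_space_countable[OF countable_blocking_configs])
  interpret PC: pair_sigma_finite ?P ?C ..
  obtain B where B: "\<And>\<zeta>. \<zeta> \<in> blocking_configs \<Longrightarrow> \<bar>g \<zeta>\<bar> \<le> B"
    using g by (auto simp: bounded_iff)
  define H where "H \<omega> \<zeta> = g \<zeta> * indicator (?S \<zeta>) \<omega>" for \<omega> \<zeta>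
  have S: "?S \<zeta> \<in> sets ?P" for \<zeta> by (rule chain_at_sets[OF \<eta> t])
  have H: "case_prod H \<in> borel_measurable (?P \<Otimes>\<^sub>M ?C)"
    unfolding case_prod_unfold
    by (rule measurable_compose_countable'[where f = "\<lambda>\<zeta> z. H (fst z) \<zeta>" and g = snd])
       (use S countable_blocking_configs in \<open>auto simp: H_def\<close>)
  have "(\<integral>\<^sup>+z. ennreal (norm (case_prod H z)) \<partial>(?P \<Otimes>\<^sub>M ?C)) =
      (\<integral>\<^sup>+\<zeta>. \<integral>\<^sup>+\<omega>. ennreal (norm (H \<omega> \<zeta>)) \<partial>?P \<partial>?C)"
    using H by (subst PC.nn_integral_snd[symmetric]) auto
  also have "\<dots> \<le> (\<integral>\<^sup>+\<zeta>. ennreal B * transition t \<eta> \<zeta> \<partial>?C)"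
  proof (rule nn_integral_mono)
    fix \<zeta> assume "\<zeta> \<in> space ?C"
    then have "\<bar>g \<zeta>\<bar> \<le> B" using B by simp
    then have "(\<integral>\<^sup>+\<omega>. ennreal (norm (H \<omega> \<zeta>)) \<partial>?P) \<le> (\<integral>\<^sup>+\<omega>. ennreal B * indicator (?S \<zeta>) \<omega> \<partial>?P)"
      by (intro nn_integral_mono) (auto simp: H_def abs_mult intro: ennreal_leI split: split_indicator)
    also have "\<dots> = ennreal B * transition t \<eta> \<zeta>"
      using S by (simp add: nn_integral_cmult_indicator transition_def)
    finally show "(\<integral>\<^sup>+\<omega>. ennreal (norm (H \<omega> \<zeta>)) \<partial>?P) \<le> \<dots>" .
  qed
  also have "\<dots> = ennreal B * (\<integral>\<^sup>+\<zeta>. transition t \<eta> \<zeta> \<partial>?C)" by (rule nn_integral_cmult) simp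
  also have "\<dots> \<le> ennreal B * 1" by (intro mult_left_mono nn_integral_transition_le[OF \<eta> t]) simp
  also have "\<dots> < \<infinity>" by simp
  finally have int: "integrable (?P \<Otimes>\<^sub>M ?C) (case_prod H)"
    using H by (intro integrableI_bounded) auto
  have "semigroup p t g \<eta> = (\<integral>\<omega>. (\<integral>\<zeta>. H \<omega> \<zeta> \<partial>?C) \<partial>?P)"
    unfolding semigroup_def
  proof (intro Bochner_Integration.integral_cong refl)
    fix \<omega>
    show "(case chain_at p \<omega> \<eta> t of None \<Rightarrow> 0 | Some \<zeta> \<Rightarrow> g \<zeta>) = (\<integral>\<zeta>. H \<omega> \<zeta> \<partial>?C)"
    proof (cases "chain_at p \<omega> \<eta> t")
      case (Some \<xi>)
      then have "\<xi> \<in> blocking_configs"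
        using chain_at_eq_Some_iff[OF t] jump_chain_in_blocking[OF \<eta>] by metis
      then have "(\<integral>\<zeta>. H \<omega> \<zeta> \<partial>?C) = (\<integral>\<zeta>. g \<xi> * indicator {\<xi>} \<zeta> \<partial>?C)" 
        using Some by (intro Bochner_Integration.integral_cong) (auto simp: H_def split: split_indicator)
      also have "\<dots> = g \<xi>" using \<open>\<xi> \<in> blocking_configs\<close> by (simp add: measure_count_space)
      finally show ?thesis using Some by simp
    qed (simp add: H_def)
  qed
  also have "\<dots> = (\<integral>\<zeta>. (\<integral>\<omega>. H \<omega> \<zeta> \<partial>?P) \<partial>?C)"
    using PC.Fubini_integral[of H] int by simp
  also have "\<dots> = (\<integral>\<zeta>. g \<zeta> * enn2real (transition t \<eta> \<zeta>) \<partial>?C)"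
    using S by (simp add: H_def transition_def measure_def)
  finally show ?thesis .
qed

end

context decaying_potential
begin

section \<open>Reversibility\<close>

text \<open>The local energies in the hypothesis differ from \<open>relative_energy\<close> by the same amount before and
  after the exchange. Exchanging back swaps the two sites, hence the reindexing by
  \<open>prod.swap\<close>.\<close>

lemma weight_detailed_balance:
  assumes db: "detailed_balance J p" and chain: "exclusion_chain p"
    and \<xi>: "\<xi> \<in> blocking_configs" and \<zeta>: "\<zeta> \<in> blocking_configs"
  shows "ennreal (weight \<xi>) * exclusion_chain.jump_rate p \<xi> \<zeta> =
    ennreal (weight \<zeta>) * exclusion_chain.jump_rate p \<zeta> \<xi>"
proof -
  interpret exclusion_chain p by (rule chain)
  have single: "weight \<xi> * p x y \<xi> = weight (exchange x y \<xi>) * p y x (exchange x y \<xi>)" for x y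
  proof -
    let ?\<xi>' = "exchange x y \<xi>"
    have "p x y \<xi> * exp (- local_energy J x y \<xi>) = p y x ?\<xi>' * exp (- local_energy J x y ?\<xi>')"
      using db by (simp add: detailed_balance_def)
    moreover have "weight \<xi> = exp (- local_energy J x y \<xi>) * exp (local_energy J x y \<xi> - relative_energy \<xi>)"
      by (simp add: weight_def exp_add[symmetric])
    moreover have "weight ?\<xi>' = exp (- local_energy J x y ?\<xi>') * exp (local_energy J x y \<xi> - relative_energy \<xi>)"
      using relative_energy_exchange[OF \<xi>, of x y] by (simp add: weight_def exp_add[symmetric])
    ultimately show ?thesis by (metis mult.assoc mult.commute)
  qed
  have "ennreal (weight \<xi>) * jump_rate \<xi> \<zeta> =
      (\<integral>\<^sup>+j. ennreal (weight \<xi>) * (case j of (x, y) \<Rightarrow> if exchange x y \<xi> = \<zeta> then ennreal (p x y \<xi>) else 0) \<partial>count_space UNIV)"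
    unfolding jump_rate_def by (rule nn_integral_cmult[symmetric]) simp
  also have "\<dots> = (\<integral>\<^sup>+j. ennreal (weight \<zeta>) * (case prod.swap j of (x, y) \<Rightarrow> if exchange x y \<zeta> = \<xi> then ennreal (p x y \<zeta>) else 0) \<partial>count_space UNIV)"
  proof (rule nn_integral_cong)
    fix j :: "int \<times> int"
    obtain x y where j: "j = (x, y)" by (cases j)
    have "exchange x y \<xi> = \<zeta> \<longleftrightarrow> exchange y x \<zeta> = \<xi>" by (metis exchange_exchange)
    then show "ennreal (weight \<xi>) * (case j of (x, y) \<Rightarrow> if exchange x y \<xi> = \<zeta> then ennreal (p x y \<xi>) else 0) =
        ennreal (weight \<zeta>) * (case prod.swap j of (x, y) \<Rightarrow> if exchange x y \<zeta> = \<xi> then ennreal (p x y \<zeta>) else 0)"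
      using single[of x y] weight_pos p_nonneg by (auto simp: j ennreal_mult'[symmetric] less_imp_le)
  qed
  also have "\<dots> = (\<integral>\<^sup>+j. ennreal (weight \<zeta>) * (case j of (x, y) \<Rightarrow> if exchange x y \<zeta> = \<xi> then ennreal (p x y \<zeta>) else 0) \<partial>count_space UNIV)"
    by (rule nn_integral_bij_count_space) (rule bij_swap)
  also have "\<dots> = ennreal (weight \<zeta>) * jump_rate \<zeta> \<xi>"
    unfolding jump_rate_def by (rule nn_integral_cmult) simp
  finally show ?thesis .
qed

text \<open>Both sides are the integral of \<open>f \<eta> * g \<zeta>\<close> against the joint law of two states at time distance \<open>t\<close>,
  which is symmetric.\<close>

lemma reversible_gibbs_limit:
  assumes rates: "exclusion_rates p" and standing: "standing_assumptions p"
    and db: "detailed_balance J p"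
  shows "reversible p gibbs_limit"
proof -
  interpret exclusion_chain p
    using rates standing by unfold_locales (auto simp: exclusion_rates_def standing_assumptions_def)
  let ?C = "count_space blocking_configs"
  interpret C: sigma_finite_measure ?C
    by (rule sigma_finite_measure_count_space_countable[OF countable_blocking_configs])
  interpret CC: pair_sigma_finite ?C ?C ..
  define \<pi> where "\<pi> \<eta> = weight \<eta> / total_weight" for \<eta>
  have \<pi>_nonneg: "0 \<le> \<pi> \<eta>" for \<eta> using weight_pos[of \<eta>] total_weight_pos by (simp add: \<pi>_def)
  have \<pi>_sum: "(\<integral>\<^sup>+\<eta>. ennreal (\<pi> \<eta>) \<partial>?C) < \<infinity>"
  proof -
    have "\<pi> summable_on blocking_configs"
      unfolding \<pi>_def divide_inverse by (intro summable_on_cmult_left weight_summable)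
    then show ?thesis using \<pi>_nonneg by (simp add: nn_integral_count_space_eq_infsum)
  qed
  have expectation: "(LINT \<eta>:blocking_configs|gibbs_limit. F \<eta>) = (\<integral>\<eta>. \<pi> \<eta> * F \<eta> \<partial>?C)"
    for F :: "config \<Rightarrow> real"
  proof -
    have "(LINT \<eta>:blocking_configs|gibbs_limit. F \<eta>) =
        measure_pmf.expectation gibbs_pmf (\<lambda>\<eta>. indicator blocking_configs \<eta> *\<^sub>R F \<eta>)"
      unfolding set_lebesgue_integral_def
      by (intro integral_gibbs_limit borel_measurable_countable_support[OF countable_blocking_configs]) simp
    also have "\<dots> = (\<integral>\<eta>. pmf gibbs_pmf \<eta> * (indicator blocking_configs \<eta> *\<^sub>R F \<eta>) \<partial>count_space UNIV)"
      unfolding measure_pmf_eq_density by (subst integral_density) auto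
    also have "\<dots> = (\<integral>\<eta>. indicator blocking_configs \<eta> *\<^sub>R (\<pi> \<eta> * F \<eta>) \<partial>count_space UNIV)"
      by (intro Bochner_Integration.integral_cong) (auto simp: pmf_gibbs_pmf \<pi>_def split: split_indicator)
    also have "\<dots> = (\<integral>\<eta>. \<pi> \<eta> * F \<eta> \<partial>restrict_space (count_space UNIV) blocking_configs)"
      by (subst integral_restrict_space) (auto simp: set_lebesgue_integral_def)
    finally show ?thesis by (simp add: restrict_count_space)
  qed
  show ?thesis
    unfolding reversible_def
  proof (intro allI impI)
    fix t :: real and f g :: "config \<Rightarrow> real"
    assume t: "0 \<le> t" and fg: "bounded (f ` blocking_configs) \<and> bounded (g ` blocking_configs)"
    obtain A where A: "\<And>\<zeta>. \<zeta> \<in> blocking_configs \<Longrightarrow> \<bar>f \<zeta>\<bar> \<le> A" using fg by (auto simp: bounded_iff)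
    obtain B where B: "\<And>\<zeta>. \<zeta> \<in> blocking_configs \<Longrightarrow> \<bar>g \<zeta>\<bar> \<le> B" using fg by (auto simp: bounded_iff)
    have AB: "0 \<le> A" "0 \<le> B" using A B heaviside_in_blocking by force+
    define R where "R \<eta> \<zeta> = enn2real (transition t \<eta> \<zeta>)" for \<eta> \<zeta>
    have R: "ennreal (R \<eta> \<zeta>) = transition t \<eta> \<zeta>" for \<eta> \<zeta>
      unfolding R_def using transition_le_1[of t \<eta> \<zeta>] by (intro ennreal_enn2real) (auto intro: le_less_trans)
    have R_nonneg: "0 \<le> R \<eta> \<zeta>" for \<eta> \<zeta> by (simp add: R_def)
    have sym: "\<pi> \<eta> * R \<eta> \<zeta> = \<pi> \<zeta> * R \<zeta> \<eta>"
      if "\<eta> \<in> blocking_configs" "\<zeta> \<in> blocking_configs" for \<eta> \<zeta>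
    proof -
      have "ennreal (weight \<eta>) * transition t \<eta> \<zeta> = ennreal (weight \<zeta>) * transition t \<zeta> \<eta>"
        by (rule transition_reversible[OF weight_detailed_balance[OF db exclusion_chain_axioms] that t])
      then have "weight \<eta> * R \<eta> \<zeta> = weight \<zeta> * R \<zeta> \<eta>"
        using weight_pos R_nonneg
        by (simp add: R[symmetric] ennreal_mult[symmetric] less_imp_le)
      then show ?thesis by (simp add: \<pi>_def)
    qed
    define H where "H \<eta> \<zeta> = \<pi> \<eta> * (f \<eta> * (g \<zeta> * R \<eta> \<zeta>))" for \<eta> \<zeta>
    have meas: "case_prod K \<in> borel_measurable (?C \<Otimes>\<^sub>M ?C)" for K :: "config \<Rightarrow> config \<Rightarrow> real"
      using countable_blocking_configs
      by (intro measurable_pair_measure_countable1) auto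
    have int: "integrable (?C \<Otimes>\<^sub>M ?C) (case_prod H)"
    proof (rule integrableI_bounded[OF meas])
      have "(\<integral>\<^sup>+z. ennreal (norm (case_prod H z)) \<partial>(?C \<Otimes>\<^sub>M ?C)) =
          (\<integral>\<^sup>+\<eta>. \<integral>\<^sup>+\<zeta>. ennreal (norm (H \<eta> \<zeta>)) \<partial>?C \<partial>?C)"
        using meas[of H] by (subst C.nn_integral_fst[symmetric]) auto
      also have "\<dots> \<le> (\<integral>\<^sup>+\<eta>. \<integral>\<^sup>+\<zeta>. ennreal (A * B) * ennreal (\<pi> \<eta>) * transition t \<eta> \<zeta> \<partial>?C \<partial>?C)"
      proof (intro nn_integral_mono)
        fix \<eta> \<zeta> assume "\<eta> \<in> space ?C" "\<zeta> \<in> space ?C"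
        then have "\<bar>f \<eta>\<bar> * \<bar>g \<zeta>\<bar> \<le> A * B" using A B by (intro mult_mono) (auto intro: AB)
        then have "(\<bar>f \<eta>\<bar> * \<bar>g \<zeta>\<bar>) * (\<pi> \<eta> * R \<eta> \<zeta>) \<le> (A * B) * (\<pi> \<eta> * R \<eta> \<zeta>)"
          using \<pi>_nonneg R_nonneg by (intro mult_right_mono) auto
        then have "norm (H \<eta> \<zeta>) \<le> A * B * \<pi> \<eta> * R \<eta> \<zeta>"
          using \<pi>_nonneg R_nonneg by (simp add: H_def abs_mult mult_ac)
        then show "ennreal (norm (H \<eta> \<zeta>)) \<le> ennreal (A * B) * ennreal (\<pi> \<eta>) * transition t \<eta> \<zeta>"
          using \<pi>_nonneg R_nonneg AB by (simp add: R[symmetric] ennreal_mult[symmetric] ennreal_leI)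
      qed
      also have "\<dots> \<le> (\<integral>\<^sup>+\<eta>. ennreal (A * B) * ennreal (\<pi> \<eta>) * 1 \<partial>?C)"
      proof (rule nn_integral_mono)
        fix \<eta> assume "\<eta> \<in> space ?C"
        then have "ennreal (A * B) * ennreal (\<pi> \<eta>) * (\<integral>\<^sup>+\<zeta>. transition t \<eta> \<zeta> \<partial>?C) \<le>
            ennreal (A * B) * ennreal (\<pi> \<eta>) * 1"
          using t by (intro mult_left_mono nn_integral_transition_le) auto
        then show "(\<integral>\<^sup>+\<zeta>. ennreal (A * B) * ennreal (\<pi> \<eta>) * transition t \<eta> \<zeta> \<partial>?C) \<le>
            ennreal (A * B) * ennreal (\<pi> \<eta>) * 1"
          by (simp add: nn_integral_cmult)
      qed
      also have "\<dots> = ennreal (A * B) * (\<integral>\<^sup>+\<eta>. ennreal (\<pi> \<eta>) \<partial>?C)"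
        by (simp add: nn_integral_cmult)
      also have "\<dots> < \<infinity>" using \<pi>_sum by (simp add: ennreal_mult_less_top)
      finally show "(\<integral>\<^sup>+z. ennreal (norm (case_prod H z)) \<partial>(?C \<Otimes>\<^sub>M ?C)) < \<infinity>" .
    qed
    have "(LINT \<eta>:blocking_configs|gibbs_limit. f \<eta> * semigroup p t g \<eta>) = (\<integral>\<eta>. (\<integral>\<zeta>. H \<eta> \<zeta> \<partial>?C) \<partial>?C)"
      unfolding expectation using fg
      by (intro Bochner_Integration.integral_cong) (auto simp: semigroup_eq[OF _ t] H_def R_def)
    also have "\<dots> = (\<integral>\<zeta>. (\<integral>\<eta>. H \<eta> \<zeta> \<partial>?C) \<partial>?C)"
      using CC.Fubini_integral[of H] int by simp
    also have "\<dots> = (\<integral>\<zeta>. (\<integral>\<eta>. \<pi> \<zeta> * (g \<zeta> * (f \<eta> * R \<zeta> \<eta>)) \<partial>?C) \<partial>?C)"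
    proof (intro Bochner_Integration.integral_cong refl)
      fix \<eta> \<zeta> assume "\<eta> \<in> space ?C" "\<zeta> \<in> space ?C"
      then have "\<pi> \<eta> * R \<eta> \<zeta> = \<pi> \<zeta> * R \<zeta> \<eta>" by (intro sym) auto
      then have "(\<pi> \<eta> * R \<eta> \<zeta>) * (f \<eta> * g \<zeta>) = (\<pi> \<zeta> * R \<zeta> \<eta>) * (f \<eta> * g \<zeta>)" by simp
      then show "H \<eta> \<zeta> = \<pi> \<zeta> * (g \<zeta> * (f \<eta> * R \<zeta> \<eta>))" by (simp add: H_def mult_ac)
    qed
    also have "\<dots> = (LINT \<eta>:blocking_configs|gibbs_limit. g \<eta> * semigroup p t f \<eta>)"
      unfolding expectation using fg
      by (intro Bochner_Integration.integral_cong) (auto simp: semigroup_eq[OF _ t] R_def)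
    finally show "(LINT \<eta>:blocking_configs|gibbs_limit. f \<eta> * semigroup p t g \<eta>) =
        (LINT \<eta>:blocking_configs|gibbs_limit. g \<eta> * semigroup p t f \<eta>)" .
  qed
qed

end

theorem theoremA1:
  fixes J :: "int set \<Rightarrow> real"
  assumes summable: "\<And>x. (\<lambda>R. \<bar>J R\<bar>) summable_on {R. finite R \<and> x \<in> R}"
    and invariant: "\<And>R k. finite R \<Longrightarrow> card R \<ge> 2 \<Longrightarrow> J ((\<lambda>x. x + k) ` R) = J R"
    and right: "filterlim (\<lambda>x. J {x}) at_bot at_top"
    and left: "filterlim (\<lambda>x. J {x}) at_top at_bot"
    and right_fast: "(\<lambda>x. exp (2 * J {x})) summable_on {1..}"
    and left_fast: "(\<lambda>x. exp (- 2 * J {x})) summable_on {..0}"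
  shows "\<exists>\<nu>. converges_weakly (gibbs J) \<nu> \<and> blocking_measure \<nu> \<and>
    (\<forall>p. exclusion_rates p \<and> standing_assumptions p \<and> detailed_balance J p \<longrightarrow>
      reversible p \<nu>)"
proof -
  interpret decaying_potential J
    using summable invariant right_fast left_fast by unfold_locales
  show ?thesis
    using gibbs_converges blocking_gibbs_limit reversible_gibbs_limit by blast
qed

end
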